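(* Let $\alpha\in\mathbb{C}$ and let $f$ be a function on $\mathbb{R}$ with Fourier transform $\widetilde{f}$, such that the differintegrals and transforms below are defined. Then $$\mathcal{F}[f^{(\alpha)}(t)]=(i\omega)^{\alpha}\,\widetilde{f}(\omega)\qquad\text{and}\qquad \mathcal{F}^{-1}[\widetilde{f}^{(\alpha)}(\omega)]=(-it)^{\alpha} f(t).$$
   Context: The Fourier transform is $\widetilde{f}(\omega)=\mathcal{F}[f(t)](\omega)=\frac{1}{\sqrt{2\pi}}\int_{\mathbb{R}}f(t)e^{-i\omega t}\,dt$, and $\mathcal{F}^{-1}$ is its inverse, $\mathcal{F}^{-1}[g(\omega)](t)=\frac{1}{\sqrt{2\pi}}\int_{\mathbb{R}}g(\omega)e^{i\omega t}\,d\omega$. Fractional derivative. For a test function $\phi\in\mathcal{D}(\mathbb{R})$ and $\alpha\in\mathbb{C}$, the distributional differintegral is $\phi^{(-\alpha)}(x)=\int_{\mathbb{R}}\phi(t)\,\delta^{(-\alpha)}(x-t)\,dt$, where $\delta^{(-\alpha)}(x)=\frac{x^{\alpha-1}}{\Gamma(\alpha)}H(x)$ and $H$ is the Heaviside step function. For functions $f$ that are not test functions, $f^{(-\alpha)}=\lim_{n\to\infty}\phi_n^{(-\alpha)}$, where $\{\phi_n\}$ is a sequence of test functions converging to $f$ in norm. Thus $f^{(\alpha)}(t)=\int_{\mathbb{R}}f(\tau)\,\delta^{(\alpha)}(t-\tau)\,d\tau$ is the fractional derivative of order $\alpha$, and $\widetilde{f}^{(\alpha)}(\omega)$ denotes the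 fractional derivative of order $\alpha$ of $\widetilde f$ in the variable $\omega$. Any necessary branch cuts for complex powers are taken along the negative imaginary axis: $\arg z\in(-\frac{\pi}{2},\frac{3\pi}{2})$. *)

theory Defs
  imports "HOL-Analysis.Analysis" "HOL-Probability.Essential_Supremum"
begin

definition fourier :: "(real \<Rightarrow> complex) \<Rightarrow> real \<Rightarrow> complex" where
  "fourier f \<omega> =
     complex_of_real (1 / sqrt (2 * pi)) *
       (LINT t|lborel. f t * exp (- (\<i> * complex_of_real \<omega> * complex_of_real t)))"

definition inv_fourier :: "(real \<Rightarrow> complex) \<Rightarrow> real \<Rightarrow> complex" where
  "inv_fourier g t =
     complex_of_real (1 / sqrt (2 * pi)) *
       (LINT \<omega>|lborel. g \<omega> * exp (\<i> * complex_of_real \<omega> * complex_of_real t))"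

(* Complex powers with the cut along the negative imaginary axis. Since Arg2pi takes values in
   [0, 2 pi), arg_cut takes values in [-pi/2, 3 pi/2). The points i w with w < 0 and -i t with
   t > 0 lie on the cut itself; there the argument is -pi/2, so that the power is the limit
   from the right half-plane. *)
definition arg_cut :: "complex \<Rightarrow> real" where
  "arg_cut z = Arg2pi (\<i> * z) - pi / 2"

definition cut_power :: "complex \<Rightarrow> complex \<Rightarrow> complex" where
  "cut_power z \<alpha> =
     (if z = 0 then (if \<alpha> = 0 then 1 else 0)
      else exp (\<alpha> * Complex (ln (cmod z)) (arg_cut z)))"

definition nth_deriv :: "nat \<Rightarrow> (real \<Rightarrow> complex) \<Rightarrow> real \<Rightarrow> complex" where
  "nth_deriv n = (\<lambda>f x. vector_derivative f (at x)) ^^ n"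

definition test_fun :: "(real \<Rightarrow> complex) \<Rightarrow> bool" where
  "test_fun \<phi> \<longleftrightarrow>
     (\<forall>n x. nth_deriv n \<phi> differentiable (at x)) \<and> compact (closure {x. \<phi> x \<noteq> 0})"

(* delta^(alpha) as a function; it is locally integrable exactly when Re alpha < 0
   (apart from alpha = 0, 1, 2, ..., where it is the zero function because Gamma has a pole),
   and only for Re alpha < 0 is it used below. *)
definition delta_kernel :: "complex \<Rightarrow> real \<Rightarrow> complex" where
  "delta_kernel \<alpha> x =
     (if 0 < x then complex_of_real x powr (- \<alpha> - 1) / Gamma (- \<alpha>) else 0)"

(* phi^(alpha) for a test function phi. If Re alpha < 0, then n = 0 and this is the integral of
   phi(t) delta^(alpha)(x - t). Otherwise delta^(alpha) is the distribution
   D^n delta^(alpha - n), where n is such that delta^(alpha - n) is a locally integrable function;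
   its convolution with phi is that of delta^(alpha - n) with the n-th derivative of phi.
   This does not depend on n, by partial integration, and is the analytic continuation in alpha
   of the integral. *)
definition test_differint :: "complex \<Rightarrow> (real \<Rightarrow> complex) \<Rightarrow> real \<Rightarrow> complex" where
  "test_differint \<alpha> \<phi> x =
     (let n = (LEAST n. Re \<alpha> < real n)
      in LINT t|lborel. nth_deriv n \<phi> t * delta_kernel (\<alpha> - of_nat n) (x - t))"

(* Convergence in the L^p norm, 1 <= p <= infinity; for finite p stated through its p-th power. *)
definition Lp_converges :: "ereal \<Rightarrow> (nat \<Rightarrow> real \<Rightarrow> complex) \<Rightarrow> (real \<Rightarrow> complex) \<Rightarrow> bool" where
  "Lp_converges p \<phi> f \<longleftrightarrow>
     f \<in> borel_measurable lborel \<and>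
     (if p = \<infinity>
      then (\<lambda>n. esssup lborel (\<lambda>x. ereal (cmod (\<phi> n x - f x)))) \<longlonglongrightarrow> 0
      else (\<lambda>n. \<integral>\<^sup>+x. ennreal (cmod (\<phi> n x - f x) powr real_of_ereal p) \<partial>lborel) \<longlonglongrightarrow> 0)"

definition distr_converges :: "(nat \<Rightarrow> real \<Rightarrow> complex) \<Rightarrow> (real \<Rightarrow> complex) \<Rightarrow> bool" where
  "distr_converges u g \<longleftrightarrow>
     (\<forall>a b. set_integrable lborel {a..b} g) \<and>
     (\<forall>\<psi>. test_fun \<psi> \<longrightarrow>
       (\<lambda>n. LINT x|lborel. u n x * \<psi> x) \<longlonglongrightarrow> (LINT x|lborel. g x * \<psi> x))"

(* g is a version of f^(alpha). The limit of the phi_n^(alpha) is that of distributions, so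
   convergence in any L^q norm is included. It is a relation, not a function: g is
   determined at most almost everywhere and, for Re alpha <= 0, the choice of phi_n may add
   a polynomial to g. *)
definition has_differint ::
    "ereal \<Rightarrow> complex \<Rightarrow> (real \<Rightarrow> complex) \<Rightarrow> (real \<Rightarrow> complex) \<Rightarrow> bool" where
  "has_differint p \<alpha> f g \<longleftrightarrow>
     (\<exists>\<phi>. (\<forall>n. test_fun (\<phi> n)) \<and> Lp_converges p \<phi> f \<and>
       distr_converges (\<lambda>n. test_differint \<alpha> (\<phi> n)) g)"

end

theory Submission
  imports Defs "HOL-Probability.Probability" "HOL-Complex_Analysis.Complex_Analysis"
begin

text \<open>Let \<open>K x = x powr (\<gamma> - 1) / Gamma \<gamma>\<close> for \<open>x > 0\<close>, with \<open>\<gamma> = n - \<alpha>\<close> and \<open>Re \<gamma> > 0\<close>, so that the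
  differintegral of a test function \<open>\<phi>\<close> is the convolution of its \<open>n\<close>-th derivative with \<open>K\<close>. Testing
  it against a derivative of order \<open>k\<close> of \<open>\<psi>\<close> moves all derivatives to the other side and leaves the
  convolution of \<open>\<phi>\<close> with \<open>W\<close>, where \<open>W\<close> is the convolution of \<open>K\<close> with the derivative of order \<open>n + k\<close>
  of \<open>\<psi>\<close>. For large \<open>k\<close> the function \<open>W\<close> decays like \<open>1 / x\<^sup>2\<close>, hence is integrable and bounded, and the
  identity survives the limit in any Lebesgue norm.

  The Laplace transform of \<open>K\<close> is \<open>z powr (- \<gamma>)\<close> for \<open>Re z > 0\<close>, by analytic continuation from the
  Gamma integral at real \<open>z\<close>. Letting \<open>z\<close> tend to \<open>\<i> * \<omega>\<close> from the right, which matches the choice of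
  the argument on the cut, the transform of \<open>W\<close> is \<open>(\<i> * \<omega>) ^ k * (\<i> * \<omega>) powr \<alpha>\<close> times that of \<open>\<psi>\<close>.
  Comparing transforms and dividing by that of \<open>\<psi>\<close> gives the first claim. For the second one, the
  convolution of the Fourier transform of \<open>f\<close> with \<open>W\<close> is the transform of \<open>f\<close> times a bounded
  function, and Fourier inversion applies to that product because its transform is integrable.\<close>

section \<open>Convolutions and transforms of integrable functions\<close>

definition conv :: "(real \<Rightarrow> complex) \<Rightarrow> (real \<Rightarrow> complex) \<Rightarrow> real \<Rightarrow> complex" where
  "conv f g s = (LINT t|lborel. f t * g (s - t))"

lemma lborel_integral_reflect:
  fixes f :: "real \<Rightarrow> 'a :: {banach, second_countable_topology}"
  shows "(LINT t|lborel. f (s - t)) = (LINT t|lborel. f t)"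
  using lborel_integral_real_affine[of "-1" f s] by simp

lemma lborel_integral_translate:
  fixes f :: "real \<Rightarrow> 'a :: {banach, second_countable_topology}"
  shows "(LINT t|lborel. f (t - s)) = (LINT t|lborel. f t)"
  using lborel_integral_real_affine[of 1 f "-s"] by simp

lemma integrable_reflect:
  fixes f :: "real \<Rightarrow> 'a :: {banach, second_countable_topology}"
  assumes "integrable lborel f"
  shows "integrable lborel (\<lambda>t. f (s - t))"
  using lborel_integrable_real_affine[OF assms, of "-1" s] by simp

lemma integrable_translate:
  fixes f :: "real \<Rightarrow> 'a :: {banach, second_countable_topology}"
  assumes "integrable lborel f"
  shows "integrable lborel (\<lambda>t. f (t - s))"
  using lborel_integrable_real_affine[OF assms, of 1 "-s"] by simp

lemma conv_commute: "conv f g = conv g f"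
proof
  fix s
  show "conv f g s = conv g f s"
    using lborel_integral_reflect[of "\<lambda>t. f (s - t) * g t" s] by (simp add: conv_def mult.commute)
qed

lemma integrable_mult_bounded:
  fixes f h :: "real \<Rightarrow> complex"
  assumes "integrable lborel f" "h \<in> borel_measurable borel" "\<And>x. norm (h x) \<le> C"
  shows "integrable lborel (\<lambda>x. f x * h x)"
proof (rule Bochner_Integration.integrable_bound)
  show "integrable lborel (\<lambda>x. C * norm (f x))"
    using assms(1) by auto
  show "(\<lambda>x. f x * h x) \<in> borel_measurable lborel"
    using assms by auto
  show "AE x in lborel. norm (f x * h x) \<le> norm (C * norm (f x))"
  proof (rule AE_I2)
    fix x
    have "norm (f x) * norm (h x) \<le> norm (f x) * C"
      by (intro mult_left_mono assms) auto
    moreover have "C \<ge> 0" using assms(3)[of 0] norm_ge_zero order_trans by blast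
    ultimately show "norm (f x * h x) \<le> norm (C * norm (f x))"
      by (simp add: norm_mult mult.commute)
  qed
qed

lemma norm_conv_le:
  assumes "integrable lborel f" "h \<in> borel_measurable borel" "\<And>x. norm (h x) \<le> C"
  shows "norm (conv f h s) \<le> C * (LINT t|lborel. norm (f t))"
proof -
  have C: "C \<ge> 0" using assms(3)[of 0] norm_ge_zero order_trans by blast
  have "norm (conv f h s) \<le> (LINT t|lborel. C * norm (f t))"
    unfolding conv_def
  proof (rule Bochner_Integration.integral_norm_bound_integral)
    show "integrable lborel (\<lambda>t. f t * h (s - t))"
      by (rule integrable_mult_bounded[OF assms(1) _ assms(3)]) (use assms(2) in measurable)
    show "integrable lborel (\<lambda>x. C * norm (f x))"
      using assms(1) by auto
    show "norm (f x * h (s - x)) \<le> C * norm (f x)" for x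
      using mult_right_mono[OF assms(3)[of "s - x"], of "norm (f x)"]
      by (simp add: norm_mult mult.commute)
  qed
  then show ?thesis by simp
qed

lemma integrable_conv_pair:
  fixes f g :: "real \<Rightarrow> complex"
  assumes f: "integrable lborel f" and g: "integrable lborel g"
  shows "integrable (lborel \<Otimes>\<^sub>M lborel) (\<lambda>(t, x). f t * g (x - t))"
proof (rule lborel_pair.Fubini_integrable)
  have [measurable]: "f \<in> borel_measurable borel" "g \<in> borel_measurable borel"
    using borel_measurable_integrable[OF f] borel_measurable_integrable[OF g] by simp_all
  show "(\<lambda>(t, x). f t * g (x - t)) \<in> borel_measurable (lborel \<Otimes>\<^sub>M lborel)"
    by measurable
  have "(LINT y|lborel. norm (case (x, y) of (t, x) \<Rightarrow> f t * g (x - t)))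
     = norm (f x) * (LINT y|lborel. norm (g y))" for x
    using lborel_integral_translate[of "\<lambda>y. norm (g y)" x] by (simp add: norm_mult)
  then show "integrable lborel (\<lambda>x. LINT y|lborel. norm (case (x, y) of (t, x) \<Rightarrow> f t * g (x - t)))"
    using f by simp
  show "AE x in lborel. integrable lborel (\<lambda>y. case (x, y) of (t, x) \<Rightarrow> f t * g (x - t))"
    using integrable_translate[OF g] by simp
qed

lemma
  fixes f g :: "real \<Rightarrow> complex"
  assumes f: "integrable lborel f" and g: "integrable lborel g"
  shows integrable_conv: "integrable lborel (conv f g)"
    and integral_conv:
      "(LINT x|lborel. conv f g x) = (LINT t|lborel. f t) * (LINT t|lborel. g t)"
proof -
  note I = integrable_conv_pair[OF f g]
  show "integrable lborel (conv f g)"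
    using lborel_pair.integrable_snd[OF I] unfolding conv_def[abs_def] by simp
  have "(LINT x|lborel. conv f g x) = (LINT t|lborel. (LINT x|lborel. f t * g (x - t)))"
    unfolding conv_def using lborel_pair.Fubini_integral[OF I] by simp
  also have "\<dots> = (LINT t|lborel. f t) * (LINT t|lborel. g t)"
    using lborel_integral_translate[of g] by simp
  finally show "(LINT x|lborel. conv f g x) = (LINT t|lborel. f t) * (LINT t|lborel. g t)" .
qed

text \<open>Boundedness of \<open>h\<close> lets \<open>C\<close> times the two-factor integrand
  dominate, so Fubini applies. This suits the later choices of \<open>h\<close>: weighted test
  functions and interval indicators.\<close>

lemma conv_assoc:
  fixes f g h :: "real \<Rightarrow> complex"
  assumes f: "integrable lborel f" and g: "integrable lborel g"
    and h[measurable]: "h \<in> borel_measurable borel" and C: "\<And>x. norm (h x) \<le> C"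
  shows "conv (conv f g) h = conv f (conv g h)"
proof
  fix s
  have [measurable]: "f \<in> borel_measurable borel" "g \<in> borel_measurable borel"
    using borel_measurable_integrable[OF f] borel_measurable_integrable[OF g] by simp_all
  have I: "integrable (lborel \<Otimes>\<^sub>M lborel) (\<lambda>(t, x). f t * g (x - t) * h (s - x))"
  proof (rule Bochner_Integration.integrable_bound)
    show "integrable (lborel \<Otimes>\<^sub>M lborel) (\<lambda>z. C * norm (case z of (t, x) \<Rightarrow> f t * g (x - t)))"
      using integrable_conv_pair[OF f g] by simp
    show "AE z in lborel \<Otimes>\<^sub>M lborel. norm (case z of (t, x) \<Rightarrow> f t * g (x - t) * h (s - x))
       \<le> norm (C * norm (case z of (t, x) \<Rightarrow> f t * g (x - t)))"
    proof (rule AE_I2)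
      fix z :: "real \<times> real"
      obtain t x where z: "z = (t, x)" by force
      have "C \<ge> 0" using C[of 0] norm_ge_zero order_trans by blast
      moreover have "norm (f t * g (x - t)) * norm (h (s - x)) \<le> norm (f t * g (x - t)) * C"
        by (intro mult_left_mono C) auto
      ultimately show "norm (case z of (t, x) \<Rightarrow> f t * g (x - t) * h (s - x))
         \<le> norm (C * norm (case z of (t, x) \<Rightarrow> f t * g (x - t)))"
        by (simp add: z norm_mult mult_ac)
    qed
  qed measurable
  have "conv (conv f g) h s = (LINT x|lborel. LINT t|lborel. f t * g (x - t) * h (s - x))"
    by (simp add: conv_def)
  also have "\<dots> = (LINT t|lborel. LINT x|lborel. f t * g (x - t) * h (s - x))"
    using lborel_pair.Fubini_integral[OF I] by simp
  also have "(\<lambda>t. LINT x|lborel. f t * g (x - t) * h (s - x)) =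
     (\<lambda>t. f t * (LINT x|lborel. g (x - t) * h (s - x)))"
    by (simp add: mult.assoc)
  also have "(\<lambda>t. LINT x|lborel. g (x - t) * h (s - x)) = (\<lambda>t. conv g h (s - t))"
  proof
    fix t
    show "(LINT x|lborel. g (x - t) * h (s - x)) = conv g h (s - t)"
      using lborel_integral_translate[of "\<lambda>x. g x * h (s - t - x)" t] by (simp add: conv_def)
  qed
  finally show "conv (conv f g) h s = conv f (conv g h) s"
    by (simp add: conv_def)
qed

section \<open>Exponential weights and the two-sided Laplace transform\<close>

abbreviation expw :: "complex \<Rightarrow> (real \<Rightarrow> complex) \<Rightarrow> real \<Rightarrow> complex" where
  "expw z f \<equiv> (\<lambda>x. f x * exp (- (z * of_real x)))"

text \<open>The weights at \<open>t\<close> and \<open>s - t\<close> multiply to the weight at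
  \<open>s\<close>, which leaves the integral. This yields the product rule for transforms, and it
  also turns convolutions with the nonintegrable kernel into convolutions of integrable
  functions.\<close>

lemma conv_expw: "conv (expw z f) (expw z g) = expw z (conv f g)"
proof
  fix s
  have "f t * exp (- (z * of_real t)) * (g (s - t) * exp (- (z * of_real (s - t))))
      = f t * g (s - t) * exp (- (z * of_real s))" for t
  proof -
    have "exp (- (z * of_real t)) * exp (- (z * of_real (s - t))) = exp (- (z * of_real s))"
      unfolding exp_add[symmetric] by (simp add: algebra_simps)
    then show ?thesis by (metis (no_types, opaque_lifting) mult.assoc mult.commute)
  qed
  then have "conv (expw z f) (expw z g) s
      = (LINT t|lborel. f t * g (s - t) * exp (- (z * of_real s)))"
    unfolding conv_def by presburger
  also have "\<dots> = expw z (conv f g) s"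
    unfolding conv_def by (rule integral_mult_left_zero)
  finally show "conv (expw z f) (expw z g) s = expw z (conv f g) s" .
qed

text \<open>On the imaginary axis this is the Fourier transform without its normalising factor, so
  half-plane and frequency arguments share one object.\<close>

definition laplace :: "(real \<Rightarrow> complex) \<Rightarrow> complex \<Rightarrow> complex" where
  "laplace f z = (LINT x|lborel. f x * exp (- (z * of_real x)))"

lemma laplace_conv:
  assumes "integrable lborel (expw z f)" "integrable lborel (expw z g)"
  shows "laplace (conv f g) z = laplace f z * laplace g z"
  using integral_conv[OF assms] by (simp add: laplace_def conv_expw)

lemma integrable_expw_imaginary:
  assumes "integrable lborel f"
  shows "integrable lborel (expw (\<i> * of_real \<omega>) f)"
proof (rule integrable_mult_bounded[OF assms, of _ 1])
  show "norm (exp (- (\<i> * of_real \<omega> * of_real x))) \<le> 1" for x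
    by simp
qed measurable

lemma norm_laplace_imaginary_le:
  "norm (laplace f (\<i> * of_real \<omega>)) \<le> (LINT x|lborel. norm (f x))"
  using integral_norm_bound[of lborel "expw (\<i> * of_real \<omega>) f"]
  by (simp add: laplace_def norm_mult)

lemma continuous_laplace_imaginary:
  assumes "integrable lborel f"
  shows "isCont (\<lambda>\<omega>. laplace f (\<i> * of_real \<omega>)) \<omega>"
  unfolding continuous_at_sequentially comp_def
proof (intro allI impI)
  fix u assume u: "u \<longlonglongrightarrow> \<omega>"
  have [measurable]: "f \<in> borel_measurable borel"
    using borel_measurable_integrable[OF assms] by simp
  show "(\<lambda>n. laplace f (\<i> * of_real (u n))) \<longlonglongrightarrow> laplace f (\<i> * of_real \<omega>)"
    unfolding laplace_def
  proof (rule integral_dominated_convergence[where w="\<lambda>x. norm (f x)"])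
    show "AE x in lborel. (\<lambda>n. expw (\<i> * of_real (u n)) f x) \<longlonglongrightarrow> expw (\<i> * of_real \<omega>) f x"
      by (intro AE_I2 tendsto_intros u)
  qed (use assms in \<open>auto simp: norm_mult\<close>)
qed

lemma measurable_laplace_imaginary [measurable]:
  assumes "integrable lborel f"
  shows "(\<lambda>\<omega>. laplace f (\<i> * of_real \<omega>)) \<in> borel_measurable borel"
  by (rule borel_measurable_continuous_onI)
     (use continuous_laplace_imaginary[OF assms] in \<open>simp add: continuous_at_imp_continuous_on\<close>)

section \<open>Test functions\<close>

lemma has_vector_derivative_reflect:
  fixes f :: "real \<Rightarrow> complex"
  assumes "\<And>x. (f has_vector_derivative f' x) (at x)"
  shows "((\<lambda>t. f (s - t)) has_vector_derivative - f' (s - t)) (at t)"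
proof -
  have "((\<lambda>t. s - t) has_vector_derivative -1) (at t)"
    by (auto intro!: derivative_eq_intros)
  from vector_diff_chain_at[OF this assms] show ?thesis by (simp add: comp_def)
qed

lemma nth_deriv_0 [simp]: "nth_deriv 0 f = f"
  by (simp add: nth_deriv_def)

lemma nth_deriv_Suc: "nth_deriv (Suc n) f = (\<lambda>x. vector_derivative (nth_deriv n f) (at x))"
  by (simp add: nth_deriv_def)

text \<open>\<open>test_fun\<close> speaks of all iterated derivatives; a class \<open>P\<close>
  closed under differentiation contains them all by induction, which replaces formulas for higher
  derivatives.\<close>

lemma test_funI:
  assumes "P f"
    and step: "\<And>f. P f \<Longrightarrow> \<exists>f'. P f' \<and> (\<forall>x. (f has_vector_derivative f' x) (at x))"
    and supp: "\<And>x. x \<notin> {a..b} \<Longrightarrow> f x = 0"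
  shows "test_fun f"
proof -
  have P: "P (nth_deriv n f)" for n
  proof (induction n)
    case (Suc n)
    from step[OF Suc] obtain f' where f': "P f'" "\<And>x. (nth_deriv n f has_vector_derivative f' x) (at x)"
      by blast
    have "nth_deriv (Suc n) f = f'"
      using vector_derivative_at[OF f'(2)] by (auto simp: nth_deriv_Suc)
    with f' show ?case by simp
  qed (use \<open>P f\<close> in simp)
  have "nth_deriv n f differentiable (at x)" for n x
    using step[OF P[of n]] by (auto intro: differentiableI_vector)
  moreover have "{x. f x \<noteq> 0} \<subseteq> {a..b}"
    using supp by blast
  then have "compact (closure {x. f x \<noteq> 0})"
    using bounded_subset[OF bounded_closed_interval] by (simp add: compact_closure)
  ultimately show ?thesis
    by (simp add: test_fun_def)
qed

lemma nth_deriv_has_vector_derivative: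
  assumes "test_fun \<phi>"
  shows "(nth_deriv n \<phi> has_vector_derivative nth_deriv (Suc n) \<phi> x) (at x)"
  using assms unfolding test_fun_def nth_deriv_Suc
  by (simp add: vector_derivative_works[symmetric])

lemma continuous_nth_deriv:
  assumes "test_fun \<phi>"
  shows "continuous_on A (nth_deriv n \<phi>)"
  by (intro continuous_at_imp_continuous_on ballI)
     (rule has_vector_derivative_continuous[OF nth_deriv_has_vector_derivative[OF assms]])

text \<open>One \<open>R\<close> serves every order: off the support the function is locally zero,
  so all its derivatives vanish there.\<close>

lemma nth_deriv_support:
  assumes "test_fun \<phi>"
  obtains R where "R > 0" "\<And>n x. x \<notin> {-R<..<R} \<Longrightarrow> nth_deriv n \<phi> x = 0"
proof -
  from assms have "bounded {x. \<phi> x \<noteq> 0}"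
    unfolding test_fun_def by (auto intro: bounded_subset[OF compact_imp_bounded closure_subset])
  then obtain R0 where R0: "\<And>x. \<phi> x \<noteq> 0 \<Longrightarrow> \<bar>x\<bar> \<le> R0"
    unfolding bounded_iff by auto
  \<comment> \<open>The added \<open>1\<close> makes all derivatives vanish at the end points
    \<open>-R\<close> and \<open>R\<close> as well, which partial integration needs.\<close>
  define R where "R = \<bar>R0\<bar> + 1"
  have "nth_deriv n \<phi> x = 0" if "\<bar>x\<bar> > R0" for n x
    using that
  proof (induction n arbitrary: x)
    case 0
    then show ?case using R0[of x] by fastforce
  next
    case (Suc n)
    have op: "open {y::real. \<bar>y\<bar> > R0}"
      by (intro open_Collect_less continuous_intros)
    have "(nth_deriv n \<phi> has_vector_derivative 0) (at x)"
      by (rule has_vector_derivative_transform_within_open[of "\<lambda>_. 0" 0 x, OF _ op])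
         (use Suc in auto)
    then show ?case
      by (simp add: nth_deriv_Suc vector_derivative_at)
  qed
  then have "nth_deriv n \<phi> x = 0" if "x \<notin> {-R<..<R}" for n x
    using that by (force simp: R_def)
  moreover have "R > 0" by (simp add: R_def)
  ultimately show thesis using that by blast
qed

lemma
  fixes f :: "real \<Rightarrow> complex"
  assumes cont: "continuous_on UNIV f" and supp: "\<And>x. x \<notin> {a..b} \<Longrightarrow> f x = 0"
  shows integrable_compact_support: "integrable lborel f"
    and bounded_compact_support: "\<exists>C. \<forall>x. norm (f x) \<le> C"
proof -
  have "set_integrable lborel {a..b} f"
    by (rule borel_integrable_atLeastAtMost') (rule continuous_on_subset[OF cont subset_UNIV])
  moreover have "(\<lambda>x. indicator {a..b} x *\<^sub>R f x) = f"
    using supp by (auto simp: indicator_def)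
  ultimately show "integrable lborel f"
    by (simp add: set_integrable_def)
  have "compact (f ` {a..b})"
    by (intro compact_continuous_image continuous_on_subset[OF cont]) auto
  then obtain C where C: "\<And>x. x \<in> {a..b} \<Longrightarrow> norm (f x) \<le> C"
    using compact_imp_bounded bounded_iff by (metis imageI)
  have "norm (f x) \<le> max C 0" for x
    using C[of x] supp[of x] by (cases "x \<in> {a..b}") auto
  then show "\<exists>C. \<forall>x. norm (f x) \<le> C" by blast
qed

lemma
  assumes "test_fun \<phi>"
  shows integrable_expw_nth_deriv: "integrable lborel (expw z (nth_deriv n \<phi>))"
    and bounded_expw_nth_deriv: "\<exists>C. \<forall>x. norm (expw z (nth_deriv n \<phi>) x) \<le> C"
proof -
  from nth_deriv_support[OF assms] obtain R where R: "R > 0"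
    "\<And>n x. x \<notin> {-R<..<R} \<Longrightarrow> nth_deriv n \<phi> x = 0" by blast
  have c: "continuous_on UNIV (expw z (nth_deriv n \<phi>))"
    by (intro continuous_intros continuous_nth_deriv assms)
  have z: "expw z (nth_deriv n \<phi>) x = 0" if "x \<notin> {-R..R}" for x
    using that R(2)[of x] by auto
  show "integrable lborel (expw z (nth_deriv n \<phi>))"
    by (rule integrable_compact_support[OF c z])
  show "\<exists>C. \<forall>x. norm (expw z (nth_deriv n \<phi>) x) \<le> C"
    by (rule bounded_compact_support[OF c z])
qed

lemma integrable_nth_deriv:
  assumes "test_fun \<phi>"
  shows "integrable lborel (nth_deriv n \<phi>)"
  using integrable_expw_nth_deriv[OF assms, where z=0 and n=n] by simp

lemma measurable_nth_deriv:
  assumes "test_fun \<phi>"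
  shows "nth_deriv n \<phi> \<in> borel_measurable borel"
  using borel_measurable_integrable[OF integrable_nth_deriv[OF assms]] by simp

text \<open>The boundary terms vanish because \<open>u\<close> is zero at \<open>a\<close> and
  \<open>b\<close>. As \<open>v\<close> is differentiated on \<open>{a..b}\<close> only, it may be
  singular elsewhere, like a power of \<open>x - t\<close> with \<open>x\<close> beyond the
  support.\<close>

lemma integral_by_parts_compact_support:
  fixes u u' v v' :: "real \<Rightarrow> complex"
  assumes ab: "a \<le> b"
    and u: "\<And>t. (u has_vector_derivative u' t) (at t)"
    and cu': "continuous_on {a..b} u'"
    and supp: "\<And>t. t \<notin> {a<..<b} \<Longrightarrow> u t = 0" "\<And>t. t \<notin> {a<..<b} \<Longrightarrow> u' t = 0"
    and v: "\<And>t. t \<in> {a..b} \<Longrightarrow> (v has_vector_derivative v' t) (at t)"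
    and cv': "continuous_on {a..b} v'"
  shows "(LINT t|lborel. u' t * v t) = - (LINT t|lborel. u t * v' t)"
proof -
  have cu: "continuous_on {a..b} u" and cv: "continuous_on {a..b} v"
    using has_vector_derivative_continuous[OF u] has_vector_derivative_continuous[OF v]
    by (auto intro!: continuous_at_imp_continuous_on)
  have 1: "set_integrable lborel {a..b} (\<lambda>t. u' t * v t)"
    by (intro borel_integrable_atLeastAtMost' continuous_intros cu' cv)
  have 2: "set_integrable lborel {a..b} (\<lambda>t. u t * v' t)"
    by (intro borel_integrable_atLeastAtMost' continuous_intros cu cv')
  have i: "(\<lambda>t. indicator {a..b} t *\<^sub>R (u' t * v t)) = (\<lambda>t. u' t * v t)"
    "(\<lambda>t. indicator {a..b} t *\<^sub>R (u t * v' t)) = (\<lambda>t. u t * v' t)"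
    using supp by (force simp: indicator_def)+
  have "has_bochner_integral lborel (\<lambda>t. indicator {a..b} t *\<^sub>R (u t * v' t + u' t * v t))
     (u b * v b - u a * v a)"
  proof (rule has_bochner_integral_FTC_Icc[OF ab])
    show "((\<lambda>t. u t * v t) has_vector_derivative u t * v' t + u' t * v t) (at t within {a..b})"
      if "a \<le> t" "t \<le> b" for t
      using that by (intro has_vector_derivative_mult has_vector_derivative_at_within[OF u]
          has_vector_derivative_at_within[OF v]) auto
    show "continuous_on {a..b} (\<lambda>t. u t * v' t + u' t * v t)"
      by (intro continuous_intros cu cu' cv cv')
  qed
  then have "has_bochner_integral lborel (\<lambda>t. u t * v' t + u' t * v t) (u b * v b - u a * v a)"
    unfolding scaleR_add_right fun_cong[OF i(1)] fun_cong[OF i(2)] .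
  moreover have "u a = 0" "u b = 0" by (auto intro: supp)
  ultimately have "(LINT t|lborel. u t * v' t + u' t * v t) = 0"
    by (simp add: has_bochner_integral_iff)
  then show ?thesis
    using 1 2 i by (simp add: set_integrable_def add_eq_0_iff)
qed

text \<open>The minus sign of partial integration cancels the one from differentiating
  \<open>s - t\<close>.\<close>

lemma conv_nth_deriv_Suc:
  assumes "test_fun \<phi>" "test_fun \<psi>"
  shows "conv (nth_deriv (Suc n) \<phi>) (nth_deriv k \<psi>) = conv (nth_deriv n \<phi>) (nth_deriv (Suc k) \<psi>)"
proof
  fix s
  from nth_deriv_support[OF assms(1)] obtain R where R: "R > 0"
    "\<And>n x. x \<notin> {-R<..<R} \<Longrightarrow> nth_deriv n \<phi> x = 0" by blast
  have "(LINT t|lborel. nth_deriv (Suc n) \<phi> t * nth_deriv k \<psi> (s - t))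
     = - (LINT t|lborel. nth_deriv n \<phi> t * - nth_deriv (Suc k) \<psi> (s - t))"
  proof (rule integral_by_parts_compact_support[of "-R" R])
    show "((\<lambda>t. nth_deriv k \<psi> (s - t)) has_vector_derivative - nth_deriv (Suc k) \<psi> (s - t)) (at t)"
      for t
      by (rule has_vector_derivative_reflect[OF nth_deriv_has_vector_derivative[OF assms(2)]])
    show "continuous_on {-R..R} (\<lambda>t. - nth_deriv (Suc k) \<psi> (s - t))"
      by (intro continuous_intros continuous_on_compose2[OF continuous_nth_deriv[OF assms(2), of UNIV]])
         auto
  qed (use R assms in \<open>auto intro: nth_deriv_has_vector_derivative continuous_nth_deriv\<close>)
  then show "conv (nth_deriv (Suc n) \<phi>) (nth_deriv k \<psi>) s
      = conv (nth_deriv n \<phi>) (nth_deriv (Suc k) \<psi>) s"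
    by (simp add: conv_def)
qed

lemma conv_nth_deriv:
  assumes "test_fun \<phi>" "test_fun \<psi>"
  shows "conv (nth_deriv n \<phi>) (nth_deriv k \<psi>) = conv \<phi> (nth_deriv (n + k) \<psi>)"
  by (induction n arbitrary: k) (simp_all add: conv_nth_deriv_Suc[OF assms])

text \<open>Partial integration against the exponential. Compact support makes this valid for every
  complex \<open>z\<close>, in the half-plane and on the imaginary axis alike.\<close>

lemma laplace_nth_deriv:
  assumes "test_fun \<phi>"
  shows "laplace (nth_deriv n \<phi>) z = z ^ n * laplace \<phi> z"
proof (induction n)
  case (Suc n)
  from nth_deriv_support[OF assms] obtain R where R: "R > 0"
    "\<And>n x. x \<notin> {-R<..<R} \<Longrightarrow> nth_deriv n \<phi> x = 0" by blast
  have "laplace (nth_deriv (Suc n) \<phi>) z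
      = - (LINT t|lborel. nth_deriv n \<phi> t * (- z * exp (- (z * of_real t))))"
    unfolding laplace_def
  proof (rule integral_by_parts_compact_support[of "-R" R])
    show "((\<lambda>t. exp (- (z * of_real t))) has_vector_derivative - z * exp (- (z * of_real t))) (at t)"
      for t
      by (rule has_vector_derivative_real_field)
         (auto intro!: derivative_eq_intros)
  qed (use R assms in \<open>auto intro!: nth_deriv_has_vector_derivative continuous_nth_deriv continuous_intros\<close>)
  also have "\<dots> = z * laplace (nth_deriv n \<phi>) z"
    by (simp add: laplace_def mult.left_commute)
  finally show ?case using Suc by simp
qed simp

text \<open>Convolution at \<open>s\<close> with a derivative of \<open>\<psi>\<close> thus becomes
  a pairing with a test function, to which \<open>distr_converges\<close> applies.\<close>

lemma test_fun_reflect_nth_deriv: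
  assumes "test_fun \<psi>"
  shows "test_fun (\<lambda>x. nth_deriv k \<psi> (s - x))"
proof -
  from nth_deriv_support[OF assms] obtain R where R: "R > 0"
    "\<And>n x. x \<notin> {-R<..<R} \<Longrightarrow> nth_deriv n \<psi> x = 0" by blast
  show ?thesis
  \<comment> \<open>The factor \<open>c\<close> absorbs the sign that each differentiation of the
    reflected function brings.\<close>
  proof (rule test_funI[where P="\<lambda>f. \<exists>c k. f = (\<lambda>x. c * nth_deriv k \<psi> (s - x))"
        and a="s - R" and b="s + R"])
    show "\<exists>c k'. (\<lambda>x. nth_deriv k \<psi> (s - x)) = (\<lambda>x. c * nth_deriv k' \<psi> (s - x))"
      by (rule exI[of _ 1]) auto
  next
    fix f assume "\<exists>c k. f = (\<lambda>x. c * nth_deriv k \<psi> (s - x))"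
    then obtain c k where f: "f = (\<lambda>x. c * nth_deriv k \<psi> (s - x))" by blast
    have "((\<lambda>t. c * nth_deriv k \<psi> (s - t)) has_vector_derivative (- c) * nth_deriv (Suc k) \<psi> (s - t)) (at t)"
      for t
    proof -
      have "((\<lambda>t. nth_deriv k \<psi> (s - t)) has_vector_derivative - nth_deriv (Suc k) \<psi> (s - t)) (at t)"
      by (rule has_vector_derivative_reflect[OF nth_deriv_has_vector_derivative[OF assms]])
      from has_vector_derivative_mult_right[OF this, of c] show ?thesis by simp
    qed
    then show "\<exists>f'. (\<exists>c k. f' = (\<lambda>x. c * nth_deriv k \<psi> (s - x))) \<and>
        (\<forall>x. (f has_vector_derivative f' x) (at x))"
      unfolding f by blast
  next
    fix x assume "x \<notin> {s - R..s + R}"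
    then show "nth_deriv k \<psi> (s - x) = 0" by (intro R(2)) auto
  qed
qed

section \<open>Bump functions with nonvanishing transform\<close>

text \<open>The case \<open>P = 1\<close> is the classical flat function; a polynomial in
  \<open>1 / x\<close> makes the family closed under differentiation.\<close>

definition flat_exp :: "complex poly \<Rightarrow> real \<Rightarrow> complex" where
  "flat_exp P x = (if 0 < x then poly P (of_real (1 / x)) * of_real (exp (- 1 / x)) else 0)"

lemma poly_times_exp_minus_tendsto_0:
  fixes P :: "complex poly"
  shows "((\<lambda>y. poly P (of_real y) * of_real (exp (- y))) \<longlongrightarrow> 0) at_top"
proof -
  have "((\<lambda>y::real. y ^ i * exp (- y)) \<longlongrightarrow> 0) at_top" for i
    using tendsto_power_div_exp_0[of i] by (simp add: exp_minus field_simps)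
  then have "((\<lambda>y::real. \<Sum>i\<le>degree P. coeff P i * of_real (y ^ i * exp (- y)))
      \<longlongrightarrow> (\<Sum>i\<le>degree P. coeff P i * of_real 0)) at_top"
    by (intro tendsto_intros)
  then show ?thesis
    by (simp add: poly_altdef sum_distrib_right mult.assoc)
qed

lemma flat_exp_tendsto_0: "(flat_exp P \<longlongrightarrow> 0) (at 0)"
proof -
  have "((\<lambda>x. poly P (of_real (1 / x)) * of_real (exp (- (1 / x)))) \<longlongrightarrow> 0) (at_right (0::real))"
    using filterlim_compose[OF poly_times_exp_minus_tendsto_0[of P] filterlim_inverse_at_top_right]
    by (simp add: inverse_eq_divide)
  then have "(flat_exp P \<longlongrightarrow> 0) (at_right 0)"
    by (rule Lim_transform_eventually) (auto simp: flat_exp_def eventually_at_right_less intro: eventually_at_rightI[of 0 1])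
  moreover have "(flat_exp P \<longlongrightarrow> 0) (at_left 0)"
    by (rule tendsto_eventually) (auto simp: flat_exp_def intro!: eventually_at_leftI[of "-1"])
  ultimately show ?thesis
    by (simp add: filterlim_split_at)
qed

text \<open>With \<open>y = 1 / x\<close>, differentiation sends \<open>P y * exp (- y)\<close> to
  \<open>y\<^sup>2 * (P y - P' y) * exp (- y)\<close>; the polynomial \<open>[:0, 0, 1:]\<close> is
  the factor \<open>y\<^sup>2\<close>.\<close>

lemma flat_exp_has_vector_derivative:
  "(flat_exp P has_vector_derivative flat_exp ([:0, 0, 1:] * (P - pderiv P)) x) (at x)"
proof -
  consider "x < 0" | "x = 0" | "x > 0" by linarith
  then show ?thesis
  proof cases
    case 1
    have "(flat_exp P has_vector_derivative 0) (at x)"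
      by (rule has_vector_derivative_transform_within_open[of "\<lambda>_. 0" 0 x "{..<0}"])
         (use 1 in \<open>auto simp: flat_exp_def\<close>)
    with 1 show ?thesis by (simp add: flat_exp_def)
  next
    case 2
    have "(flat_exp P has_derivative (\<lambda>h. 0)) (at 0)"
    \<comment> \<open>Dividing by \<open>y\<close> multiplies the polynomial by its variable, so the
      difference quotient is bounded by another \<open>flat_exp\<close>, which tends to
      \<open>0\<close>.\<close>
    proof (rule has_derivativeI_sandwich[of 1])
      show "((\<lambda>y. norm (flat_exp ([:0, 1:] * P) y)) \<longlongrightarrow> 0) (at 0)"
        using tendsto_norm[OF flat_exp_tendsto_0[of "[:0, 1:] * P"]] by simp
      show "norm (flat_exp P y - flat_exp P 0 - 0) / norm (y - 0) \<le> norm (flat_exp ([:0, 1:] * P) y)"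
        if "y \<in> UNIV" "y \<noteq> 0" "dist y 0 < 1" for y
        by (auto simp: flat_exp_def norm_mult norm_divide)
    qed auto
    then show ?thesis
      using 2 by (simp add: has_vector_derivative_def flat_exp_def)
  next
    case 3
    have "((\<lambda>z. poly P (1 / z) * exp (- 1 / z)) has_field_derivative
       poly ([:0, 0, 1:] * (P - pderiv P)) (1 / of_real x) * exp (- 1 / of_real x))
       (at (of_real x :: complex))"
      using 3 by (auto intro!: derivative_eq_intros DERIV_chain2[OF poly_DERIV]
          simp: power2_eq_square divide_simps) (simp add: algebra_simps)
    from has_vector_derivative_real_field[OF this]
    have "((\<lambda>x. poly P (1 / of_real x) * exp (- 1 / of_real x)) has_vector_derivative
       poly ([:0, 0, 1:] * (P - pderiv P)) (1 / of_real x) * exp (- 1 / of_real x)) (at x)" .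
    then have "(flat_exp P has_vector_derivative
       poly ([:0, 0, 1:] * (P - pderiv P)) (1 / of_real x) * exp (- 1 / of_real x)) (at x)"
      by (rule has_vector_derivative_transform_within_open[of _ _ _ "{0<..}"])
         (use 3 in \<open>auto simp: flat_exp_def exp_of_real[symmetric]\<close>)
    with 3 show ?thesis by (simp add: flat_exp_def exp_of_real[symmetric])
  qed
qed

definition bump :: "real \<Rightarrow> real \<Rightarrow> complex" where
  "bump \<delta> x = flat_exp 1 x * flat_exp 1 (\<delta> - x)"

text \<open>The product rule turns one product into a sum of two; closing under sums gives the class
  for \<open>test_funI\<close>.\<close>

inductive bump_span :: "real \<Rightarrow> (real \<Rightarrow> complex) \<Rightarrow> bool" for \<delta> where
  prod: "bump_span \<delta> (\<lambda>x. flat_exp P x * flat_exp Q (\<delta> - x))"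
| add: "bump_span \<delta> f \<Longrightarrow> bump_span \<delta> g \<Longrightarrow> bump_span \<delta> (\<lambda>x. f x + g x)"

lemma flat_exp_uminus: "flat_exp (- P) x = - flat_exp P x"
  by (simp add: flat_exp_def)

lemma test_fun_bump: "test_fun (bump \<delta>)"
proof (rule test_funI[where P="bump_span \<delta>" and a=0 and b=\<delta>])
  show "bump_span \<delta> (bump \<delta>)"
    unfolding bump_def[abs_def] by (rule bump_span.prod)
next
  fix f assume "bump_span \<delta> f"
  then show "\<exists>f'. bump_span \<delta> f' \<and> (\<forall>x. (f has_vector_derivative f' x) (at x))"
  proof induction
    case (prod P Q)
    define D where "D P = [:0, 0, 1:] * (P - pderiv P)" for P :: "complex poly"
    have "((\<lambda>x. flat_exp P x * flat_exp Q (\<delta> - x)) has_vector_derivative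
        flat_exp P x * flat_exp (- D Q) (\<delta> - x) + flat_exp (D P) x * flat_exp Q (\<delta> - x)) (at x)" for x
    proof (rule has_vector_derivative_mult)
      show "(flat_exp P has_vector_derivative flat_exp (D P) x) (at x)"
        unfolding D_def by (rule flat_exp_has_vector_derivative)
      show "((\<lambda>x. flat_exp Q (\<delta> - x)) has_vector_derivative flat_exp (- D Q) (\<delta> - x)) (at x)"
        unfolding flat_exp_uminus D_def by (rule has_vector_derivative_reflect[OF flat_exp_has_vector_derivative])
    qed
    moreover have "bump_span \<delta> (\<lambda>x. flat_exp P x * flat_exp (- D Q) (\<delta> - x) + flat_exp (D P) x * flat_exp Q (\<delta> - x))"
      by (intro bump_span.intros)
    ultimately show ?case by blast
  next
    case (add f g)
    then obtain f' g' where "bump_span \<delta> f'" "bump_span \<delta> g'"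
      "\<And>x. (f has_vector_derivative f' x) (at x)" "\<And>x. (g has_vector_derivative g' x) (at x)"
      by blast
    then show ?case
      by (intro exI[of _ "\<lambda>x. f' x + g' x"] conjI allI bump_span.add has_vector_derivative_add)
  qed
next
  fix x assume "x \<notin> {0..\<delta>}"
  then show "bump \<delta> x = 0" by (auto simp: bump_def flat_exp_def)
qed

text \<open>For \<open>x\<close> between \<open>0\<close> and \<open>\<delta>\<close> the bound
  \<open>\<bar>\<omega> * x\<bar> \<le> 1 < pi / 2\<close> keeps the cosine positive, so the real
  part of the transform integrates a function that is positive there. A test function with nonzero
  transform at a prescribed frequency can later be divided out.\<close>

lemma laplace_bump_nonzero:
  assumes "0 < \<delta>" "\<bar>\<omega>\<bar> * \<delta> \<le> 1"
  shows "laplace (bump \<delta>) (\<i> * of_real \<omega>) \<noteq> 0"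
proof -
  define b where "b x = (if 0 < x \<and> x < \<delta> then exp (- 1 / x) * exp (- 1 / (\<delta> - x)) else 0)" for x
  have b: "bump \<delta> x = of_real (b x)" for x
    by (auto simp: bump_def flat_exp_def b_def)
  have i: "integrable lborel (expw (\<i> * of_real \<omega>) (bump \<delta>))"
    using integrable_expw_nth_deriv[OF test_fun_bump, where n=0] by simp
  have e: "Re (expw (\<i> * of_real \<omega>) (bump \<delta>) x) = b x * cos (\<omega> * x)" for x
    by (simp add: b Re_exp)
  have pos: "cos (\<omega> * x) > 0" if "0 < x" "x < \<delta>" for x
  proof (rule cos_gt_zero_pi)
    have "\<bar>\<omega> * x\<bar> \<le> \<bar>\<omega>\<bar> * \<delta>"
      using that by (simp add: abs_mult mult_left_mono)
    then have "\<bar>\<omega> * x\<bar> \<le> 1" using assms by simp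
    moreover have "1 < pi / 2" using pi_gt3 by simp
    ultimately show "- (pi / 2) < \<omega> * x" "\<omega> * x < pi / 2" by linarith+
  qed
  have I: "integrable lborel (\<lambda>x. b x * cos (\<omega> * x))"
    using integrable_Re[OF i] unfolding e .
  have nn: "b x * cos (\<omega> * x) \<ge> 0" for x
    using pos[of x] by (simp add: b_def less_imp_le)
  have "Re (laplace (bump \<delta>) (\<i> * of_real \<omega>)) = (LINT x|lborel. b x * cos (\<omega> * x))"
    unfolding laplace_def integral_Re[OF i, symmetric] e ..
  moreover have "(LINT x|lborel. b x * cos (\<omega> * x)) \<noteq> 0"
  proof
    assume "(LINT x|lborel. b x * cos (\<omega> * x)) = 0"
    then have "AE x in lborel. b x * cos (\<omega> * x) = 0"
      using integral_nonneg_eq_0_iff_AE[OF I] nn by simp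
    then have "AE x in lborel. x \<notin> {0<..<\<delta>}"
    proof eventually_elim
      case (elim x)
      then show ?case using pos[of x] by (auto simp: b_def)
    qed
    then have "emeasure lborel {0<..<\<delta>} = 0"
      by (subst (asm) AE_iff_measurable[of "{0<..<\<delta>}"]) auto
    then show False using assms by simp
  qed
  ultimately show ?thesis by fastforce
qed

section \<open>The Laplace transform of the kernel\<close>

lemma delta_kernel_eq:
  "delta_kernel (- \<gamma>) x = (if 0 < x then of_real x powr (\<gamma> - 1) / Gamma \<gamma> else 0)"
  by (simp add: delta_kernel_def)

lemma measurable_delta_kernel [measurable]: "delta_kernel \<alpha> \<in> borel_measurable borel"
  unfolding delta_kernel_def[abs_def] by measurable

lemma integrable_lborel_of_absolutely_integrable:
  fixes f :: "real \<Rightarrow> complex"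
  assumes "f absolutely_integrable_on {0<..}" "\<And>x. x \<le> 0 \<Longrightarrow> f x = 0" "f \<in> borel_measurable borel"
  shows "integrable lborel f"
proof -
  have "(\<lambda>x. indicator {0<..} x *\<^sub>R f x) = f"
    using assms(2) by (force simp: indicator_def)
  with assms show ?thesis
    by (simp add: set_integrable_def integrable_completion)
qed

text \<open>The modulus of the weight depends on \<open>Re z\<close> only, so the absolutely
  convergent Gamma integral with the real parameter \<open>Re z\<close> settles all
  \<open>z\<close>.\<close>

lemma integrable_expw_delta_kernel:
  assumes "0 < Re \<gamma>" "0 < Re z"
  shows "integrable lborel (expw z (delta_kernel (- \<gamma>)))"
proof -
  define a where "a = Re z"
  define f where "f = expw (of_real a) (delta_kernel (- \<gamma>))"
  have [measurable]: "f \<in> borel_measurable borel"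
    unfolding f_def by measurable
  have "(\<lambda>t. (of_real t powr (\<gamma> - 1) / of_real (exp (a * t))) / Gamma \<gamma>) absolutely_integrable_on {0<..}"
    using absolutely_integrable_Gamma_integral[of \<gamma> a] assms
    by (intro set_integrable_divide) (auto simp: a_def)
  then have "f absolutely_integrable_on {0<..}"
    by (rule set_integrable_cong[THEN iffD1, rotated -1])
       (auto simp: f_def delta_kernel_eq exp_minus exp_of_real field_simps simp flip: of_real_mult)
  then have "integrable lborel f"
    by (rule integrable_lborel_of_absolutely_integrable) (auto simp: f_def delta_kernel_eq)
  then show ?thesis
    by (rule Bochner_Integration.integrable_bound)
       (auto simp: f_def norm_mult a_def)
qed

text \<open>Differentiation under the integral, by dominated convergence of difference quotients.
  The mean value bound in a half-plane brings a factor \<open>x\<close>, and half of the exponential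
  decay is spent on absorbing it.\<close>

lemma laplace_holomorphic:
  assumes supp: "\<And>x. x \<le> 0 \<Longrightarrow> f x = 0"
    and int: "\<And>w. 0 < Re w \<Longrightarrow> integrable lborel (expw w f)"
  shows "laplace f holomorphic_on {z. 0 < Re z}"
proof -
  have "\<exists>D. (laplace f has_field_derivative D) (at z)" if z: "0 < Re z" for z
  proof -
    \<comment> \<open>With half of \<open>Re z\<close>, the half-plane \<open>S\<close> below is a
      convex neighbourhood of \<open>z\<close> on which the exponentials decay uniformly.\<close>
    define \<delta> where "\<delta> = Re z / 2"
    have \<delta>: "\<delta> > 0" "z \<in> {w. \<delta> < Re w}" using z by (auto simp: \<delta>_def)
    define S where "S = {w. \<delta> < Re w}"
    have S: "open S" "convex S" "z \<in> S"
      using \<delta> by (auto simp: S_def open_halfspace_Re_gt convex_halfspace_Re_gt)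
    have bound: "norm (exp (- (w * of_real x)) - exp (- (v * of_real x))) \<le> x * exp (- (\<delta> * x)) * norm (w - v)"
      if "w \<in> S" "v \<in> S" "x > 0" for w v and x :: real
    proof (rule field_differentiable_bound[OF S(2) _ _ that(1,2)])
      show "((\<lambda>w. exp (- (w * of_real x))) has_field_derivative - of_real x * exp (- (y * of_real x))) (at y within S)" for y
        by (auto intro!: derivative_eq_intros)
      show "norm (- of_real x * exp (- (y * of_real x))) \<le> x * exp (- (\<delta> * x))" if "y \<in> S" for y
        using \<open>x > 0\<close> that by (simp add: norm_mult S_def)
    qed
    have le: "x * exp (- (\<delta> * x)) \<le> 2 / \<delta> * exp (- (\<delta> / 2 * x))" if "x > 0" for x
    proof -
      have "\<delta> / 2 * x \<le> exp (\<delta> / 2 * x)"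
        using exp_ge_add_one_self[of "\<delta> / 2 * x"] by linarith
      then have "x \<le> 2 / \<delta> * exp (\<delta> / 2 * x)"
        using \<delta> by (simp add: field_simps)
      then have "x * exp (- (\<delta> * x)) \<le> 2 / \<delta> * exp (\<delta> / 2 * x) * exp (- (\<delta> * x))"
        by (rule mult_right_mono) simp
      also have "\<dots> = 2 / \<delta> * exp (- (\<delta> / 2 * x))"
        unfolding mult.assoc exp_add[symmetric] by (simp add: field_simps)
      finally show ?thesis .
    qed
    define D where "D = (LINT x|lborel. f x * (- of_real x * exp (- (z * of_real x))))"
    have [measurable]: "f \<in> borel_measurable borel"
    proof -
      have "(\<lambda>x. expw 1 f x * exp (of_real x)) \<in> borel_measurable borel"
        using borel_measurable_integrable[OF int[of 1]] by simp
      also have "(\<lambda>x. expw 1 f x * exp (of_real x)) = f"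
        by (simp add: mult.assoc flip: exp_add)
      finally show ?thesis .
    qed
    have "((\<lambda>w. (laplace f w - laplace f z) / (w - z)) \<longlongrightarrow> D) (at z within S)"
      unfolding tendsto_at_iff_sequentially comp_def
    proof (intro allI impI)
      fix X assume X: "\<forall>i. X i \<in> S - {z}" "X \<longlonglongrightarrow> z"
      have "(\<lambda>i. LINT x|lborel. f x * ((exp (- (X i * of_real x)) - exp (- (z * of_real x))) / (X i - z)))
          \<longlonglongrightarrow> D"
        unfolding D_def
      proof (rule integral_dominated_convergence[where w="\<lambda>x. 2 / \<delta> * norm (expw (of_real (\<delta> / 2)) f x)"])
        show "integrable lborel (\<lambda>x. 2 / \<delta> * norm (expw (of_real (\<delta> / 2)) f x))"
          using int[of "of_real (\<delta> / 2)"] \<delta> by (intro integrable_mult_right integrable_norm) auto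
        show "AE x in lborel. (\<lambda>i. f x * ((exp (- (X i * of_real x)) - exp (- (z * of_real x))) / (X i - z)))
          \<longlonglongrightarrow> f x * (- of_real x * exp (- (z * of_real x)))"
        proof (intro AE_I2 tendsto_intros)
          fix x :: real
          have "((\<lambda>w. exp (- (w * of_real x))) has_field_derivative - of_real x * exp (- (z * of_real x))) (at z)"
            by (auto intro!: derivative_eq_intros)
          then have "((\<lambda>w. (exp (- (w * of_real x)) - exp (- (z * of_real x))) / (w - z))
              \<longlongrightarrow> - of_real x * exp (- (z * of_real x))) (at z)"
            by (simp add: has_field_derivative_iff)
          moreover have "filterlim X (at z) sequentially"
            using X by (auto simp: filterlim_at)
          ultimately show "(\<lambda>i. (exp (- (X i * of_real x)) - exp (- (z * of_real x))) / (X i - z))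
              \<longlonglongrightarrow> - of_real x * exp (- (z * of_real x))"
            by (rule filterlim_compose)
        qed
        show "AE x in lborel. norm (f x * ((exp (- (X i * of_real x)) - exp (- (z * of_real x))) / (X i - z)))
            \<le> 2 / \<delta> * norm (expw (of_real (\<delta> / 2)) f x)" for i
        proof (rule AE_I2)
          fix x :: real
          show "norm (f x * ((exp (- (X i * of_real x)) - exp (- (z * of_real x))) / (X i - z)))
            \<le> 2 / \<delta> * norm (expw (of_real (\<delta> / 2)) f x)"
          proof (cases "x > 0")
            case True
            have "norm ((exp (- (X i * of_real x)) - exp (- (z * of_real x))) / (X i - z)) \<le> x * exp (- (\<delta> * x))"
              using bound[of "X i" z x] X S True by (simp add: norm_divide divide_le_eq)
            also note le[OF True]
            finally have "norm (f x) * norm ((exp (- (X i * of_real x)) - exp (- (z * of_real x))) / (X i - z))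
               \<le> norm (f x) * (2 / \<delta> * exp (- (\<delta> / 2 * x)))"
              by (rule mult_left_mono) simp
            then show ?thesis by (simp add: norm_mult norm_divide mult_ac)
          qed (simp add: supp)
        qed
      qed measurable
      moreover have "(LINT x|lborel. f x * ((exp (- (X i * of_real x)) - exp (- (z * of_real x))) / (X i - z)))
          = (laplace f (X i) - laplace f z) / (X i - z)" for i
      proof -
        have "X i \<in> S" using X(1) by blast
        then have "0 < Re (X i)" using \<delta>(1) by (simp add: S_def)
        then show ?thesis
          unfolding laplace_def
          using int[of "X i"] int[OF z]
          by (subst Bochner_Integration.integral_diff[symmetric])
             (simp_all add: right_diff_distrib diff_divide_distrib)
      qed
      ultimately show "(\<lambda>i. (laplace f (X i) - laplace f z) / (X i - z)) \<longlonglongrightarrow> D"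
        by (simp only:)
    qed
    then have "(laplace f has_field_derivative D) (at z within S)"
      by (simp add: has_field_derivative_iff)
    then show ?thesis
      using at_within_open[OF S(3,1)] by auto
  qed
  then show ?thesis
    unfolding holomorphic_on_def field_differentiable_def
    using has_field_derivative_at_within by blast
qed

text \<open>At \<open>1\<close> this is the Gamma integral divided by \<open>Gamma \<gamma>\<close>;
  other \<open>a\<close> follow by the substitution \<open>a * x\<close>, as the kernel is
  homogeneous of degree \<open>\<gamma> - 1\<close>.\<close>

lemma laplace_delta_kernel_real:
  assumes "0 < Re \<gamma>" "0 < a"
  shows "laplace (delta_kernel (- \<gamma>)) (of_real a) = of_real a powr (- \<gamma>)"
proof -
  have scale: "delta_kernel (- \<gamma>) (a * x) = of_real a powr (\<gamma> - 1) * delta_kernel (- \<gamma>) x" for x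
    using \<open>0 < a\<close> by (auto simp: delta_kernel_eq powr_times_real zero_less_mult_iff)
  have 1: "laplace (delta_kernel (- \<gamma>)) 1 = 1"
  proof -
    have "\<gamma> \<notin> \<int>\<^sub>\<le>\<^sub>0"
      using assms by (auto elim!: nonpos_Ints_cases)
    then have [simp]: "Gamma \<gamma> \<noteq> 0"
      by (simp add: Gamma_eq_zero_iff)
    have "((\<lambda>t. of_real t powr (\<gamma> - 1) / of_real (exp t) / Gamma \<gamma>) has_integral Gamma \<gamma> / Gamma \<gamma>) {0<..}"
      by (intro has_integral_divide Gamma_integral_complex' assms)
    then have "((\<lambda>t. if t \<in> {0<..} then of_real t powr (\<gamma> - 1) / of_real (exp t) / Gamma \<gamma> else 0)
        has_integral 1) UNIV"
      by (subst has_integral_restrict_UNIV) auto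
    also have "(\<lambda>t. if t \<in> {0<..} then of_real t powr (\<gamma> - 1) / of_real (exp t) / Gamma \<gamma> else 0)
        = expw 1 (delta_kernel (- \<gamma>))"
      by (auto simp: fun_eq_iff delta_kernel_eq exp_minus exp_of_real field_simps)
    finally have "(expw 1 (delta_kernel (- \<gamma>)) has_integral 1) UNIV" .
    moreover have "(expw 1 (delta_kernel (- \<gamma>)) has_integral laplace (delta_kernel (- \<gamma>)) 1) UNIV"
      unfolding laplace_def
      by (intro has_integral_integral_lborel integrable_expw_delta_kernel assms) simp
    ultimately show ?thesis using has_integral_unique by blast
  qed
  have "laplace (delta_kernel (- \<gamma>)) 1 = of_real a * (LINT x|lborel. expw 1 (delta_kernel (- \<gamma>)) (a * x))"
    unfolding laplace_def using \<open>0 < a\<close>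
    by (subst lborel_integral_real_affine[of a _ 0]) (auto simp: scaleR_conv_of_real)
  also have "\<dots> = of_real a * of_real a powr (\<gamma> - 1) * laplace (delta_kernel (- \<gamma>)) (of_real a)"
    unfolding laplace_def scale by (simp add: mult.assoc)
  also have "of_real a * of_real a powr (\<gamma> - 1) = of_real a powr \<gamma>"
    using \<open>0 < a\<close> by (simp add: powr_diff)
  finally have "1 = of_real a powr \<gamma> * laplace (delta_kernel (- \<gamma>)) (of_real a)"
    using 1 by (simp add: mult.assoc)
  then show ?thesis
    using \<open>0 < a\<close> by (simp add: powr_minus field_simps)
qed

text \<open>Both sides are holomorphic in the right half-plane and agree on the positive reals,
  which accumulate at \<open>1\<close>; the identity theorem does the rest.\<close>

lemma laplace_delta_kernel:
  assumes "0 < Re \<gamma>" "0 < Re z"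
  shows "laplace (delta_kernel (- \<gamma>)) z = z powr (- \<gamma>)"
proof -
  have hol: "laplace (delta_kernel (- \<gamma>)) holomorphic_on {z. 0 < Re z}"
  proof (rule laplace_holomorphic)
    show "delta_kernel (- \<gamma>) x = 0" if "x \<le> 0" for x
      using that by (simp add: delta_kernel_def)
  qed (rule integrable_expw_delta_kernel[OF assms(1)])
  have "(\<lambda>z. z powr (- \<gamma>)) holomorphic_on {z. 0 < Re z}"
    by (intro holomorphic_intros) (auto simp: complex_nonpos_Reals_iff)
  from holomorphic_on_diff[OF hol this]
  have "laplace (delta_kernel (- \<gamma>)) z - z powr (- \<gamma>) = 0"
  proof (rule analytic_continuation[where U="of_real ` {0<..}" and \<xi>=1])
    show "open {z. 0 < Re z}" by (rule open_halfspace_Re_gt)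
    show "connected {z. 0 < Re z}" by (rule convex_connected[OF convex_halfspace_Re_gt])
    show "(1::complex) islimpt of_real ` {0::real<..}"
    proof -
      have "(1::real) islimpt {0<..}"
        using open_imp_islimpt[of "{0::real<..}" 1] by simp
      then show ?thesis
        unfolding islimpt_sequential
      proof (elim exE conjE)
        fix X :: "nat \<Rightarrow> real" assume "\<forall>n. X n \<in> {0<..} - {1}" "X \<longlonglongrightarrow> 1"
        then show "\<exists>f. (\<forall>n. f n \<in> complex_of_real ` {0<..} - {1}) \<and> f \<longlonglongrightarrow> 1"
          using tendsto_of_real[of X 1 sequentially]
          by (intro exI[of _ "\<lambda>n. of_real (X n)"]) auto
      qed
    qed
  qed (use assms laplace_delta_kernel_real in auto)
  then show ?thesis by simp
qed

section \<open>Fractional derivatives of high order of test functions\<close>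

text \<open>For \<open>x > R\<close> the power is smooth on the support of \<open>\<psi>\<close>, so
  each partial integration lowers its exponent by one. The factor \<open>A\<close> is the falling
  factorial of \<open>c\<close> with \<open>j\<close> factors; what matters is that it does not
  depend on \<open>x\<close>.\<close>

lemma conv_nth_deriv_powr:
  assumes "test_fun \<psi>" and R: "R > 0" "\<And>n x. x \<notin> {-R<..<R} \<Longrightarrow> nth_deriv n \<psi> x = 0"
  obtains A where "\<And>x. R < x \<Longrightarrow>
    (LINT t|lborel. nth_deriv j \<psi> t * of_real (x - t) powr c) =
    A * (LINT t|lborel. \<psi> t * of_real (x - t) powr (c - of_nat j))"
proof -
  have "\<exists>A. \<forall>x>R. (LINT t|lborel. nth_deriv j \<psi> t * of_real (x - t) powr c) =
    A * (LINT t|lborel. \<psi> t * of_real (x - t) powr (c - of_nat j))"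
  proof (induction j arbitrary: c)
    case 0
    show ?case by (rule exI[of _ 1]) simp
  next
    case (Suc j)
    from Suc[of "c - 1"] obtain A where A: "\<And>x. R < x \<Longrightarrow>
      (LINT t|lborel. nth_deriv j \<psi> t * of_real (x - t) powr (c - 1)) =
      A * (LINT t|lborel. \<psi> t * of_real (x - t) powr (c - 1 - of_nat j))" by blast
    have "(LINT t|lborel. nth_deriv (Suc j) \<psi> t * of_real (x - t) powr c) =
        c * A * (LINT t|lborel. \<psi> t * of_real (x - t) powr (c - of_nat (Suc j)))" if x: "x > R" for x
    proof -
      have "(LINT t|lborel. nth_deriv (Suc j) \<psi> t * of_real (x - t) powr c)
        = - (LINT t|lborel. nth_deriv j \<psi> t * (- (c * of_real (x - t) powr (c - 1))))"
      proof (rule integral_by_parts_compact_support[of "-R" R])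
        show "((\<lambda>t. of_real (x - t) powr c) has_vector_derivative - (c * of_real (x - t) powr (c - 1))) (at t)"
          if "t \<in> {-R..R}" for t
        proof -
          have "((\<lambda>z. (of_real x - z) powr c) has_field_derivative - (c * (of_real x - of_real t) powr (c - 1)))
             (at (of_real t))"
            using x that by (auto intro!: derivative_eq_intros simp: complex_nonpos_Reals_iff)
          from has_vector_derivative_real_field[OF this] show ?thesis by simp
        qed
        show "continuous_on {-R..R} (\<lambda>t. - (c * of_real (x - t) powr (c - 1)))"
          using x by (intro continuous_intros) (auto simp: complex_nonpos_Reals_iff)
      qed (use R assms in \<open>auto intro: nth_deriv_has_vector_derivative continuous_nth_deriv\<close>)
      also have "\<dots> = c * (LINT t|lborel. nth_deriv j \<psi> t * of_real (x - t) powr (c - 1))"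
        by (simp add: mult.left_commute)
      finally show ?thesis
        using A[OF x] by (simp add: diff_diff_eq add.commute mult.assoc)
    qed
    then show ?case by blast
  qed
  then show thesis using that by blast
qed

lemma conv_delta_kernel_support:
  assumes "\<And>t. t \<le> - R \<Longrightarrow> f t = 0" "x \<le> - R"
  shows "conv f (delta_kernel \<alpha>) x = 0"
proof -
  have "f t * delta_kernel \<alpha> (x - t) = 0" for t
    using assms by (cases "t \<le> - R") (auto simp: delta_kernel_def)
  then have "(\<lambda>t. f t * delta_kernel \<alpha> (x - t)) = (\<lambda>t. 0)" by blast
  then show ?thesis unfolding conv_def by simp
qed

text \<open>Three regions: left of \<open>-R\<close> the convolution is zero, up to \<open>X\<close>
  it is bounded, and beyond \<open>X\<close> all \<open>j\<close> derivatives move to the power,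
  whose exponent then has real part at most \<open>-2\<close>.\<close>

lemma conv_delta_kernel_decay:
  assumes "test_fun \<psi>" and \<gamma>: "0 < Re \<gamma>" and j: "Re \<gamma> + 1 \<le> real j"
  obtains C where "\<And>x. norm (conv (nth_deriv j \<psi>) (delta_kernel (- \<gamma>)) x) \<le> C / (1 + x\<^sup>2)"
proof -
  define W where "W = conv (nth_deriv j \<psi>) (delta_kernel (- \<gamma>))"
  from nth_deriv_support[OF assms(1)] obtain R where R: "R > 0"
    "\<And>n x. x \<notin> {-R<..<R} \<Longrightarrow> nth_deriv n \<psi> x = 0" by blast
  \<comment> \<open>For \<open>x \<ge> X\<close> and \<open>\<bar>t\<bar> < R\<close> this gives
    \<open>x - t \<ge> x / 2 \<ge> 1\<close>; a base of at least \<open>1\<close> makes the power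
    monotone in the exponent.\<close>
  define X where "X = 2 * R + 2"
  define M where "M = (LINT t|lborel. norm (\<psi> t))"
  have M: "M \<ge> 0" by (simp add: M_def)
  have zero: "W x = 0" if "x \<le> - R" for x
    using that unfolding W_def by (intro conv_delta_kernel_support[of R]) (auto intro: R(2))
  obtain B where B: "\<And>x. x \<le> X \<Longrightarrow> norm (W x) \<le> B"
  proof -
    \<comment> \<open>The weight \<open>exp (- x)\<close> makes the kernel integrable while the
      weighted test function stays bounded; removing the weight costs a factor
      \<open>exp X\<close>.\<close>
    obtain D where D: "\<And>x. norm (expw 1 (nth_deriv j \<psi>) x) \<le> D"
      using bounded_expw_nth_deriv[OF assms(1)] by blast
    define B where "B = D * (LINT t|lborel. norm (expw 1 (delta_kernel (- \<gamma>)) t))"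
    have "norm (conv (expw 1 (delta_kernel (- \<gamma>))) (expw 1 (nth_deriv j \<psi>)) x) \<le> B" for x
      unfolding B_def
      by (rule norm_conv_le[OF integrable_expw_delta_kernel[OF \<gamma>] _ D])
         (use measurable_nth_deriv[OF assms(1)] in auto)
    then have B: "norm (expw 1 W x) \<le> B" for x
      by (simp only: W_def conv_expw conv_commute[of "nth_deriv j \<psi>"])
    have "norm (W x) \<le> exp X * B" if "x \<le> X" for x
    proof -
      have "norm (W x) = exp x * norm (expw 1 W x)"
      proof -
        have "norm (expw 1 W x) = norm (W x) * exp (- x)"
          by (simp add: norm_mult)
        then show ?thesis by (simp add: exp_minus)
      qed
      also have "\<dots> \<le> exp X * B"
        using that B[of x] by (intro mult_mono) auto
      finally show ?thesis .
    qed
    then show thesis using that by blast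
  qed
  obtain A where A: "\<And>x. R < x \<Longrightarrow>
    (LINT t|lborel. nth_deriv j \<psi> t * of_real (x - t) powr (\<gamma> - 1)) =
    A * (LINT t|lborel. \<psi> t * of_real (x - t) powr (\<gamma> - 1 - of_nat j))"
    using conv_nth_deriv_powr[OF assms(1) R] by blast
  \<comment> \<open>The \<open>4\<close> comes from
    \<open>(x / 2) powr (- 2) = 4 / x\<^sup>2\<close>.\<close>
  define K where "K = norm (A / Gamma \<gamma>) * M * 4"
  have far: "norm (W x) \<le> K / x\<^sup>2" if x: "x \<ge> X" for x
  proof -
    have xR: "R < x" using x R by (simp add: X_def)
    have "W x = (LINT t|lborel. nth_deriv j \<psi> t * of_real (x - t) powr (\<gamma> - 1) / Gamma \<gamma>)"
      unfolding W_def conv_def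
    proof (rule Bochner_Integration.integral_cong[OF refl])
      show "nth_deriv j \<psi> t * delta_kernel (- \<gamma>) (x - t)
          = nth_deriv j \<psi> t * of_real (x - t) powr (\<gamma> - 1) / Gamma \<gamma>" for t
        using R(2)[of t j] xR by (cases "t \<in> {-R<..<R}") (auto simp: delta_kernel_eq)
    qed
    also have "\<dots> = A / Gamma \<gamma> * (LINT t|lborel. \<psi> t * of_real (x - t) powr (\<gamma> - 1 - of_nat j))"
      using A[OF xR] by simp
    finally have "norm (W x) = norm (A / Gamma \<gamma>)
        * norm (LINT t|lborel. \<psi> t * of_real (x - t) powr (\<gamma> - 1 - of_nat j))"
      by (simp add: norm_mult norm_divide)
    also have "norm (LINT t|lborel. \<psi> t * of_real (x - t) powr (\<gamma> - 1 - of_nat j))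
        \<le> (LINT t|lborel. norm (\<psi> t) * (4 / x\<^sup>2))"
    proof (rule order_trans[OF integral_norm_bound integral_mono_AE'])
      show "integrable lborel (\<lambda>t. norm (\<psi> t) * (4 / x\<^sup>2))"
        using integrable_nth_deriv[OF assms(1), of 0] by simp
      show "AE t in lborel. norm (\<psi> t * of_real (x - t) powr (\<gamma> - 1 - of_nat j)) \<le> norm (\<psi> t) * (4 / x\<^sup>2)"
      proof (rule AE_I2)
        fix t
        show "norm (\<psi> t * of_real (x - t) powr (\<gamma> - 1 - of_nat j)) \<le> norm (\<psi> t) * (4 / x\<^sup>2)"
        proof (cases "t \<in> {-R<..<R}")
          case True
          then have t: "x - t \<ge> x / 2" "x / 2 \<ge> 1" using x by (auto simp: X_def)
          then have "norm (of_real (x - t) powr (\<gamma> - 1 - of_nat j)) = (x - t) powr (Re \<gamma> - 1 - real j)"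
            by (subst norm_powr_real_powr) auto
          also have "\<dots> \<le> (x - t) powr (- 2)"
            using t j by (intro powr_mono) auto
          also have "\<dots> \<le> (x / 2) powr (- 2)"
            using t by (intro powr_mono2') auto
          also have "\<dots> = 4 / x\<^sup>2"
            using t by (simp add: powr_minus powr_numeral field_simps power2_eq_square)
          finally show ?thesis unfolding norm_mult by (rule mult_left_mono) simp
        qed (use R(2)[of t 0] in simp)
      qed
    qed auto
    also have "\<dots> = M * (4 / x\<^sup>2)" by (simp add: M_def)
    finally show ?thesis by (simp add: K_def mult_left_mono mult.assoc)
  qed
  have K: "K \<ge> 0" using M by (simp add: K_def)
  have "B \<ge> 0" using B[of X] norm_ge_zero order_trans by blast
  \<comment> \<open>The first summand covers \<open>x \<le> X\<close>; the second uses
    \<open>1 + x\<^sup>2 \<le> 2 * x\<^sup>2\<close> for \<open>x \<ge> 1\<close>.\<close>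
  have "norm (W x) \<le> (B * (1 + X\<^sup>2) + 2 * K) / (1 + x\<^sup>2)" for x
  proof -
    have pos: "1 + x\<^sup>2 > 0" by (simp add: add_pos_nonneg)
    have "norm (W x) * (1 + x\<^sup>2) \<le> B * (1 + X\<^sup>2) + 2 * K"
    proof -
      consider "x \<le> - R" | "- R < x" "x \<le> X" | "X \<le> x" by linarith
      then show ?thesis
      proof cases
        case 1
        then show ?thesis using zero \<open>B \<ge> 0\<close> K by simp
      next
        case 2
        have "x\<^sup>2 \<le> X\<^sup>2"
          using 2 R by (intro power2_le_iff_abs_le[THEN iffD2]) (auto simp: X_def)
        then have "norm (W x) * (1 + x\<^sup>2) \<le> B * (1 + X\<^sup>2)"
          using B[OF 2(2)] \<open>B \<ge> 0\<close> by (intro mult_mono) auto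
        then show ?thesis using K by simp
      next
        case 3
        have "x \<ge> 1" using 3 R by (simp add: X_def)
        then have "1 \<le> x\<^sup>2" by simp
        then have "1 + x\<^sup>2 \<le> 2 * x\<^sup>2" by simp
        then have "norm (W x) * (1 + x\<^sup>2) \<le> K / x\<^sup>2 * (2 * x\<^sup>2)"
          using far[OF 3] K by (intro mult_mono) auto
        also have "\<dots> = 2 * K" using \<open>x \<ge> 1\<close> by simp
        finally show ?thesis using \<open>B \<ge> 0\<close> by (simp add: add_increasing)
      qed
    qed
    then show ?thesis using pos by (simp add: pos_le_divide_eq)
  qed
  then show thesis using that unfolding W_def by blast
qed

lemma measurable_conv [measurable]:
  assumes [measurable]: "f \<in> borel_measurable borel" "g \<in> borel_measurable borel"
  shows "conv f g \<in> borel_measurable borel"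
  unfolding conv_def[abs_def] by measurable

lemma integrable_1_div_1_plus_square: "integrable lborel (\<lambda>x::real. C / (1 + x\<^sup>2))"
proof -
  have "integrable lborel (\<lambda>x::real. inverse (1 + x\<^sup>2))"
    using integrable_inverse_1_plus_square by (simp add: set_integrable_def)
  then show ?thesis by (simp add: divide_inverse)
qed

lemma
  assumes "test_fun \<psi>" "0 < Re \<gamma>" "Re \<gamma> + 1 \<le> real j"
  shows integrable_conv_delta_kernel: "integrable lborel (conv (nth_deriv j \<psi>) (delta_kernel (- \<gamma>)))"
    and bounded_conv_delta_kernel: "\<exists>C. \<forall>x. norm (conv (nth_deriv j \<psi>) (delta_kernel (- \<gamma>)) x) \<le> C"
proof -
  obtain C where C: "\<And>x. norm (conv (nth_deriv j \<psi>) (delta_kernel (- \<gamma>)) x) \<le> C / (1 + x\<^sup>2)"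
    using conv_delta_kernel_decay[OF assms] by blast
  have "C / (1 + 0\<^sup>2) \<ge> 0" using C[of 0] norm_ge_zero order_trans by blast
  then have "C \<ge> 0" by simp
  have "C / (1 + x\<^sup>2) \<le> C" for x
    using \<open>C \<ge> 0\<close> by (simp add: divide_le_eq add_pos_nonneg mult_le_cancel_left1 algebra_simps)
  then show "\<exists>C. \<forall>x. norm (conv (nth_deriv j \<psi>) (delta_kernel (- \<gamma>)) x) \<le> C"
    using C order_trans by blast
  show "integrable lborel (conv (nth_deriv j \<psi>) (delta_kernel (- \<gamma>)))"
    by (rule Bochner_Integration.integrable_bound[OF integrable_1_div_1_plus_square[of C]])
       (use C \<open>C \<ge> 0\<close> measurable_nth_deriv[OF assms(1)] in \<open>auto intro!: AE_I2 order_trans[OF C] abs_ge_self\<close>)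
qed

text \<open>Since \<open>f\<close> vanishes left of \<open>-R\<close> and the real part of the
  argument is at most \<open>1\<close>, the weight is at most \<open>exp R\<close> where it counts,
  which gives the dominating function.\<close>

lemma laplace_abel_limit:
  assumes f: "integrable lborel f" and supp: "\<And>x. x \<le> - R \<Longrightarrow> f x = 0" and "R > 0"
  shows "(\<lambda>n. laplace f (of_real (1 / real (Suc n)) + \<i> * of_real \<omega>)) \<longlonglongrightarrow> laplace f (\<i> * of_real \<omega>)"
  unfolding laplace_def
proof (rule integral_dominated_convergence[where w="\<lambda>x. exp R * norm (f x)"])
  have [measurable]: "f \<in> borel_measurable borel"
    using borel_measurable_integrable[OF f] by simp
  define z where "z n = of_real (1 / real (Suc n)) + \<i> * of_real \<omega>" for n
  have "z \<longlonglongrightarrow> of_real 0 + \<i> * of_real \<omega>"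
    unfolding z_def[abs_def] by (intro tendsto_intros LIMSEQ_Suc lim_1_over_n)
  then have z: "z \<longlonglongrightarrow> \<i> * of_real \<omega>" by simp
  show "AE x in lborel. (\<lambda>n. expw (of_real (1 / real (Suc n)) + \<i> * of_real \<omega>) f x)
      \<longlonglongrightarrow> expw (\<i> * of_real \<omega>) f x"
    unfolding z_def[symmetric] by (intro AE_I2 tendsto_intros z)
  show "AE x in lborel. norm (expw (of_real (1 / real (Suc n)) + \<i> * of_real \<omega>) f x) \<le> exp R * norm (f x)" for n
  proof (rule AE_I2)
    fix x
    show "norm (expw (of_real (1 / real (Suc n)) + \<i> * of_real \<omega>) f x) \<le> exp R * norm (f x)"
    proof (cases "x \<le> - R")
      case False
      have "- (x / real (Suc n)) \<le> R / real (Suc n)"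
        using divide_right_mono[of "- x" R "real (Suc n)"] False by simp
      also have "\<dots> \<le> R" using \<open>R > 0\<close> by (simp add: field_simps)
      finally have "exp (- (x / real (Suc n))) * norm (f x) \<le> exp R * norm (f x)"
        by (intro mult_right_mono) auto
      then show ?thesis by (simp add: norm_mult mult.commute)
    qed (simp add: supp)
  qed
qed (use f borel_measurable_integrable[OF f] in auto)

text \<open>The Laplace transform of the convolution is known for \<open>Re z > 0\<close>; as the convolution is
  integrable, the value on the imaginary axis is an Abelian limit.\<close>

lemma laplace_conv_delta_kernel:
  assumes "test_fun \<psi>" "0 < Re \<gamma>" "Re \<gamma> + 1 \<le> real j" "\<omega> \<noteq> 0"
  shows "laplace (conv (nth_deriv j \<psi>) (delta_kernel (- \<gamma>))) (\<i> * of_real \<omega>)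
    = (\<i> * of_real \<omega>) ^ j * laplace \<psi> (\<i> * of_real \<omega>) * (\<i> * of_real \<omega>) powr (- \<gamma>)"
proof -
  define W where "W = conv (nth_deriv j \<psi>) (delta_kernel (- \<gamma>))"
  define z where "z n = of_real (1 / real (Suc n)) + \<i> * of_real \<omega>" for n
  have "z \<longlonglongrightarrow> of_real 0 + \<i> * of_real \<omega>"
    unfolding z_def[abs_def] by (intro tendsto_intros LIMSEQ_Suc lim_1_over_n)
  then have z: "z \<longlonglongrightarrow> \<i> * of_real \<omega>" by simp
  have Re_z: "Re (z n) > 0" for n by (simp add: z_def)
  from nth_deriv_support[OF assms(1)] obtain R where R: "R > 0"
    "\<And>n x. x \<notin> {-R<..<R} \<Longrightarrow> nth_deriv n \<psi> x = 0" by blast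
  have zero: "W x = 0" if "x \<le> - R" for x
    using that unfolding W_def by (intro conv_delta_kernel_support[of R]) (auto intro: R(2))
  have W: "integrable lborel W"
    unfolding W_def by (rule integrable_conv_delta_kernel[OF assms(1-3)])
  have \<psi>: "integrable lborel \<psi>"
    using integrable_nth_deriv[OF assms(1), of 0] by simp
  have "(\<lambda>n. laplace W (z n)) \<longlonglongrightarrow> laplace W (\<i> * of_real \<omega>)"
    unfolding z_def by (rule laplace_abel_limit[OF W zero R(1)])
  moreover have "laplace W (z n) = z n ^ j * laplace \<psi> (z n) * z n powr (- \<gamma>)" for n
    unfolding W_def
    by (simp add: laplace_conv integrable_expw_nth_deriv assms(1) integrable_expw_delta_kernel
        assms(2) Re_z laplace_nth_deriv laplace_delta_kernel)
  moreover have "(\<lambda>n. z n ^ j * laplace \<psi> (z n) * z n powr (- \<gamma>)) \<longlonglongrightarrow>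
     (\<i> * of_real \<omega>) ^ j * laplace \<psi> (\<i> * of_real \<omega>) * (\<i> * of_real \<omega>) powr (- \<gamma>)"
  \<comment> \<open>For \<open>\<omega> \<noteq> 0\<close> the limit point lies off the nonpositive
    reals, so the principal \<open>powr\<close> is continuous there.\<close>
  proof (intro tendsto_mult tendsto_power z tendsto_powr_complex tendsto_const)
    show "(\<lambda>n. laplace \<psi> (z n)) \<longlonglongrightarrow> laplace \<psi> (\<i> * of_real \<omega>)"
      unfolding z_def by (rule laplace_abel_limit[OF \<psi> _ R(1)]) (use R(2)[of _ 0] in auto)
  qed (use assms(4) in \<open>simp add: complex_nonpos_Reals_iff\<close>)
  ultimately show ?thesis
    unfolding W_def by (simp add: LIMSEQ_unique)
qed

section \<open>Passing to the limit\<close>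

text \<open>The kernel is not integrable, but both sides are conjugated to convolutions of integrable
  functions by the weight \<open>exp (- x)\<close>.\<close>

lemma conv_nth_deriv_delta_kernel:
  assumes "test_fun \<phi>" "test_fun \<psi>" "0 < Re \<gamma>"
  shows "conv (conv (nth_deriv n \<phi>) (delta_kernel (- \<gamma>))) (nth_deriv k \<psi>)
    = conv \<phi> (conv (nth_deriv (n + k) \<psi>) (delta_kernel (- \<gamma>)))"
proof -
  let ?E = "expw 1"
  let ?K = "delta_kernel (- \<gamma>)"
  have K: "integrable lborel (?E ?K)"
    by (rule integrable_expw_delta_kernel) (simp_all add: assms)
  have assoc: "conv (conv (?E ?K) (?E (nth_deriv i \<phi>))) (?E (nth_deriv j \<psi>))
      = conv (?E ?K) (conv (?E (nth_deriv i \<phi>)) (?E (nth_deriv j \<psi>)))"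
    "conv (conv (?E (nth_deriv i \<phi>)) (?E ?K)) (?E (nth_deriv j \<psi>))
      = conv (?E (nth_deriv i \<phi>)) (conv (?E ?K) (?E (nth_deriv j \<psi>)))" for i j
  proof -
    obtain C where "\<And>x. norm (?E (nth_deriv j \<psi>) x) \<le> C"
      using bounded_expw_nth_deriv[OF assms(2)] by blast
    note assoc = conv_assoc[OF _ _ _ this]
    show "conv (conv (?E ?K) (?E (nth_deriv i \<phi>))) (?E (nth_deriv j \<psi>))
      = conv (?E ?K) (conv (?E (nth_deriv i \<phi>)) (?E (nth_deriv j \<psi>)))"
      "conv (conv (?E (nth_deriv i \<phi>)) (?E ?K)) (?E (nth_deriv j \<psi>))
      = conv (?E (nth_deriv i \<phi>)) (conv (?E ?K) (?E (nth_deriv j \<psi>)))"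
      using measurable_nth_deriv[OF assms(2)]
      by (intro assoc K integrable_expw_nth_deriv assms(1); measurable)+
  qed
  have "?E (conv (conv (nth_deriv n \<phi>) ?K) (nth_deriv k \<psi>))
      = conv (conv (?E ?K) (?E (nth_deriv n \<phi>))) (?E (nth_deriv k \<psi>))"
    unfolding conv_expw by (simp only: conv_commute[of ?K])
  also have "\<dots> = conv (?E ?K) (?E (conv (nth_deriv n \<phi>) (nth_deriv k \<psi>)))"
    unfolding assoc(1) by (simp only: conv_expw)
  \<comment> \<open>All derivatives now rest on \<open>\<psi>\<close>. Writing \<open>\<phi>\<close>
    as \<open>nth_deriv 0 \<phi>\<close> matches the form of \<open>assoc\<close>.\<close>
  also have "\<dots> = conv (?E ?K) (conv (?E (nth_deriv 0 \<phi>)) (?E (nth_deriv (n + k) \<psi>)))"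
    by (simp only: conv_nth_deriv[OF assms(1,2)] conv_expw nth_deriv_0)
  also have "\<dots> = conv (conv (?E (nth_deriv 0 \<phi>)) (?E ?K)) (?E (nth_deriv (n + k) \<psi>))"
    unfolding assoc(1)[symmetric] by (simp only: conv_commute[of "?E ?K"])
  also have "\<dots> = ?E (conv \<phi> (conv (nth_deriv (n + k) \<psi>) ?K))"
    unfolding assoc(2) conv_commute[of "?E ?K"] by (simp only: conv_expw nth_deriv_0)
  finally show ?thesis
    by (simp add: fun_eq_iff)
qed

text \<open>An integrable and bounded \<open>w\<close> pairs continuously with every Lebesgue norm.
  In place of the Hoelder inequality the integrand is split at height \<open>\<eta>\<close>, which
  treats all finite exponents at once.\<close>

lemma Lp_converges_integral:
  assumes p: "1 \<le> p" and conv: "Lp_converges p \<phi> f"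
    and \<phi>: "\<And>n. \<phi> n \<in> borel_measurable borel" "\<And>n. integrable lborel (\<lambda>x. \<phi> n x * w x)"
    and f: "integrable lborel (\<lambda>x. f x * w x)"
    and w: "integrable lborel w" "\<And>x. norm (w x) \<le> C"
  shows "(\<lambda>n. LINT x|lborel. \<phi> n x * w x) \<longlonglongrightarrow> (LINT x|lborel. f x * w x)"
proof -
  have [measurable]: "f \<in> borel_measurable borel" "w \<in> borel_measurable borel"
    using conv borel_measurable_integrable[OF w(1)] by (simp_all add: Lp_converges_def)
  note \<phi>(1)[measurable]
  define M where "M = (LINT x|lborel. norm (w x))"
  have M: "M \<ge> 0" by (simp add: M_def)
  have M_eq: "(\<integral>\<^sup>+x. ennreal (norm (w x)) \<partial>lborel) = ennreal M"
    unfolding M_def using w(1) by (intro nn_integral_eq_integral) auto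
  have C: "C \<ge> 0" using w(2)[of 0] norm_ge_zero order_trans by blast
  have key: "\<forall>\<^sub>F n in sequentially.
      (\<integral>\<^sup>+x. ennreal (norm (\<phi> n x - f x) * norm (w x)) \<partial>lborel) \<le> ennreal (\<eta> * (M + 1))" if \<eta>: "\<eta> > 0" for \<eta>
  proof (cases "p = \<infinity>")
    case True
    then have "(\<lambda>n. esssup lborel (\<lambda>x. ereal (norm (\<phi> n x - f x)))) \<longlonglongrightarrow> 0"
      using conv by (simp add: Lp_converges_def)
    then have "\<forall>\<^sub>F n in sequentially. esssup lborel (\<lambda>x. ereal (norm (\<phi> n x - f x))) < ereal \<eta>"
      using \<eta> by (intro order_tendstoD) auto
    then show ?thesis
    proof eventually_elim
      case (elim n)
      have "AE x in lborel. ereal (norm (\<phi> n x - f x)) \<le> esssup lborel (\<lambda>x. ereal (norm (\<phi> n x - f x)))"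
        by (rule esssup_AE)
      then have "AE x in lborel. norm (\<phi> n x - f x) \<le> \<eta>"
      proof eventually_elim
        case (elim x)
        then have "ereal (norm (\<phi> n x - f x)) < ereal \<eta>"
          using \<open>esssup lborel _ < ereal \<eta>\<close> by (rule le_less_trans)
        then show ?case by simp
      qed
      then have "(\<integral>\<^sup>+x. ennreal (norm (\<phi> n x - f x) * norm (w x)) \<partial>lborel)
          \<le> (\<integral>\<^sup>+x. ennreal \<eta> * ennreal (norm (w x)) \<partial>lborel)"
        using \<eta> by (intro nn_integral_mono_AE)
          (auto simp: mult_right_mono simp flip: ennreal_mult elim!: eventually_mono)
      also have "\<dots> = ennreal (\<eta> * M)"
        using \<eta> M by (simp add: nn_integral_cmult M_eq ennreal_mult)
      also have "\<dots> \<le> ennreal (\<eta> * (M + 1))"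
        using \<eta> by (intro ennreal_leI) simp
      finally show ?case .
    qed
  next
    case False
    define r where "r = real_of_ereal p"
    have r: "r \<ge> 1"
      using p False unfolding r_def by (cases p) auto
    \<comment> \<open>Where \<open>d = norm (\<phi> n x - f x)\<close> exceeds
      \<open>\<eta>\<close>, one has \<open>d \<le> \<eta> powr (1 - r) * d powr r\<close>; with
      \<open>norm (w x) \<le> C\<close> this gives the coefficient.\<close>
    define B where "B = C * \<eta> powr (1 - r)"
    have B: "B \<ge> 0" using C by (simp add: B_def)
    have "(\<lambda>n. \<integral>\<^sup>+x. ennreal (norm (\<phi> n x - f x) powr r) \<partial>lborel) \<longlonglongrightarrow> 0"
      using conv False by (simp add: Lp_converges_def r_def)
    \<comment> \<open>The threshold is chosen so that \<open>B\<close> times it is at most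
      \<open>\<eta>\<close>, also for \<open>B = 0\<close>.\<close>
    then have "\<forall>\<^sub>F n in sequentially.
        (\<integral>\<^sup>+x. ennreal (norm (\<phi> n x - f x) powr r) \<partial>lborel) < ennreal (\<eta> / (B + 1))"
      using \<eta> B by (intro order_tendstoD) (auto simp: ennreal_zero_less_divide ennreal_less_zero_iff)
    then show ?thesis
    proof eventually_elim
      case (elim n)
      have pt: "norm (\<phi> n x - f x) * norm (w x)
          \<le> \<eta> * norm (w x) + B * norm (\<phi> n x - f x) powr r" for x
      proof (cases "norm (\<phi> n x - f x) \<le> \<eta>")
        case True
        then have "norm (\<phi> n x - f x) * norm (w x) \<le> \<eta> * norm (w x)"
          by (rule mult_right_mono) simp
        then show ?thesis using B by (simp add: add_increasing2)
      next
        case False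
        define d where "d = norm (\<phi> n x - f x)"
        have d: "d > \<eta>" using False by (simp add: d_def)
        then have "d = d powr (1 - r) * d powr r"
          using \<eta> by (simp flip: powr_add)
        also have "\<dots> \<le> \<eta> powr (1 - r) * d powr r"
          using d \<eta> r by (intro mult_right_mono powr_mono2') auto
        finally have "d * norm (w x) \<le> \<eta> powr (1 - r) * d powr r * C"
          using w(2) by (intro mult_mono) auto
        then show ?thesis
          using \<eta> by (simp add: B_def d_def add_increasing mult_ac)
      qed
      have "(\<integral>\<^sup>+x. ennreal (norm (\<phi> n x - f x) * norm (w x)) \<partial>lborel)
          \<le> (\<integral>\<^sup>+x. ennreal \<eta> * ennreal (norm (w x)) + ennreal B * ennreal (norm (\<phi> n x - f x) powr r) \<partial>lborel)"
        using \<eta> B pt by (intro nn_integral_mono)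
          (simp add: ennreal_leI flip: ennreal_mult ennreal_plus)
      also have "\<dots> = ennreal \<eta> * ennreal M
          + ennreal B * (\<integral>\<^sup>+x. ennreal (norm (\<phi> n x - f x) powr r) \<partial>lborel)"
        by (simp add: nn_integral_add nn_integral_cmult M_eq)
      also have "\<dots> \<le> ennreal \<eta> * ennreal M + ennreal B * ennreal (\<eta> / (B + 1))"
        using elim by (intro add_left_mono mult_left_mono) auto
      also have "\<dots> = ennreal (\<eta> * M + B * (\<eta> / (B + 1)))"
        using \<eta> M B by (simp only: ennreal_plus ennreal_mult mult_nonneg_nonneg divide_nonneg_nonneg
            less_imp_le add_nonneg_nonneg zero_le_one)
      also have "\<dots> \<le> ennreal (\<eta> * (M + 1))"
      proof (rule ennreal_leI)
        have "B * (\<eta> / (B + 1)) \<le> \<eta>" using B \<eta> by (simp add: field_simps)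
        then show "\<eta> * M + B * (\<eta> / (B + 1)) \<le> \<eta> * (M + 1)" by (simp add: algebra_simps)
      qed
      finally show ?case .
    qed
  qed
  show ?thesis
  proof (rule tendstoI)
    fix e :: real assume "e > 0"
    \<comment> \<open>This makes the bound \<open>\<eta> * (M + 1)\<close> equal to
      \<open>e / 2\<close>; the added \<open>1\<close> covers \<open>M = 0\<close>.\<close>
    define \<eta> where "\<eta> = e / (2 * (M + 1))"
    have "\<eta> > 0" using \<open>e > 0\<close> M by (simp add: \<eta>_def)
    from key[OF this] show "\<forall>\<^sub>F n in sequentially.
      dist (LINT x|lborel. \<phi> n x * w x) (LINT x|lborel. f x * w x) < e"
    proof eventually_elim
      case (elim n)
      have "ennreal (dist (LINT x|lborel. \<phi> n x * w x) (LINT x|lborel. f x * w x))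
          = ennreal (norm (LINT x|lborel. (\<phi> n x - f x) * w x))"
        unfolding dist_norm by (subst Bochner_Integration.integral_diff[symmetric, OF \<phi>(2) f]) (simp add: left_diff_distrib)
      also have "\<dots> \<le> (\<integral>\<^sup>+x. ennreal (norm ((\<phi> n x - f x) * w x)) \<partial>lborel)"
        using \<phi>(2)[of n] f by (intro integral_norm_bound_ennreal) (simp add: left_diff_distrib)
      also have "\<dots> \<le> ennreal (\<eta> * (M + 1))"
        using elim by (simp add: norm_mult)
      finally have "dist (LINT x|lborel. \<phi> n x * w x) (LINT x|lborel. f x * w x) \<le> \<eta> * (M + 1)"
        using \<open>\<eta> > 0\<close> M by (subst (asm) ennreal_le_iff) auto
      also have "\<dots> = e / 2" using M by (simp add: \<eta>_def field_simps)
      finally show ?case using \<open>e > 0\<close> by simp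
    qed
  qed
qed

section \<open>Smoothing kernels and the convolution identity for differintegrals\<close>

definition deriv_order :: "complex \<Rightarrow> nat" where
  "deriv_order \<alpha> = (LEAST n. Re \<alpha> < real n)"

lemma Re_less_deriv_order: "Re \<alpha> < real (deriv_order \<alpha>)"
  unfolding deriv_order_def using reals_Archimedean2 by (rule LeastI_ex)

lemma test_differint_eq_conv:
  "test_differint \<alpha> \<phi> = conv (nth_deriv (deriv_order \<alpha>) \<phi>) (delta_kernel (- (of_nat (deriv_order \<alpha>) - \<alpha>)))"
  by (simp add: fun_eq_iff test_differint_def conv_def deriv_order_def Let_def)

text \<open>In effect the derivative of order \<open>\<alpha> + k\<close> of \<open>\<psi>\<close>.
  The \<open>k\<close> extra derivatives buy the decay that makes it integrable and bounded.\<close>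

definition smoothing_kernel :: "complex \<Rightarrow> nat \<Rightarrow> (real \<Rightarrow> complex) \<Rightarrow> real \<Rightarrow> complex" where
  "smoothing_kernel \<alpha> k \<psi> = conv (nth_deriv (deriv_order \<alpha> + k) \<psi>)
     (delta_kernel (- (of_nat (deriv_order \<alpha>) - \<alpha>)))"

text \<open>The bound on \<open>k\<close> is exactly the decay condition
  \<open>Re \<gamma> + 1 \<le> j\<close> for \<open>\<gamma> = n - \<alpha>\<close> and
  \<open>j = n + k\<close>. In the transform, \<open>n\<close> powers of
  \<open>\<i> * \<omega>\<close> combine with the exponent \<open>- \<gamma>\<close> to the exponent
  \<open>\<alpha>\<close>.\<close>

lemma
  assumes "test_fun \<psi>" "1 - Re \<alpha> \<le> real k"
  shows integrable_smoothing_kernel: "integrable lborel (smoothing_kernel \<alpha> k \<psi>)"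
    and bounded_smoothing_kernel: "\<exists>C. \<forall>x. norm (smoothing_kernel \<alpha> k \<psi> x) \<le> C"
    and laplace_smoothing_kernel: "\<omega> \<noteq> 0 \<Longrightarrow> laplace (smoothing_kernel \<alpha> k \<psi>) (\<i> * of_real \<omega>)
      = (\<i> * of_real \<omega>) ^ k * (\<i> * of_real \<omega>) powr \<alpha> * laplace \<psi> (\<i> * of_real \<omega>)"
proof -
  let ?n = "deriv_order \<alpha>"
  have 1: "0 < Re (of_nat ?n - \<alpha>)"
    using Re_less_deriv_order[of \<alpha>] by simp
  have 2: "Re (of_nat ?n - \<alpha>) + 1 \<le> real (?n + k)"
    using assms(2) by simp
  show "integrable lborel (smoothing_kernel \<alpha> k \<psi>)"
    unfolding smoothing_kernel_def by (rule integrable_conv_delta_kernel[OF assms(1) 1 2])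
  show "\<exists>C. \<forall>x. norm (smoothing_kernel \<alpha> k \<psi> x) \<le> C"
    unfolding smoothing_kernel_def by (rule bounded_conv_delta_kernel[OF assms(1) 1 2])
  assume \<omega>: "\<omega> \<noteq> 0"
  have "(\<i> * of_real \<omega>) powr \<alpha> = (\<i> * of_real \<omega>) powr (of_nat ?n + - (of_nat ?n - \<alpha>))"
    by simp
  also have "\<dots> = (\<i> * of_real \<omega>) ^ ?n * (\<i> * of_real \<omega>) powr (- (of_nat ?n - \<alpha>))"
    unfolding powr_add using \<omega> by (subst powr_complexpow) auto
  finally show "laplace (smoothing_kernel \<alpha> k \<psi>) (\<i> * of_real \<omega>)
      = (\<i> * of_real \<omega>) ^ k * (\<i> * of_real \<omega>) powr \<alpha> * laplace \<psi> (\<i> * of_real \<omega>)"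
    unfolding smoothing_kernel_def laplace_conv_delta_kernel[OF assms(1) 1 2 \<omega>]
    by (simp only: power_add mult_ac)
qed

text \<open>The pairing of the approximants with a reflected derivative of \<open>\<psi>\<close> has
  two limits: the distributional one gives \<open>g\<close>, and moving derivatives and kernel to
  \<open>\<psi>\<close> gives \<open>f\<close>. Integrability is assumed of the product, so that
  \<open>f\<close> may be integrable or, for the second claim, a bounded Fourier transform.\<close>

lemma has_differint_conv:
  assumes p: "1 \<le> p" and fg: "has_differint p \<alpha> f g" and \<psi>: "test_fun \<psi>" and k: "1 - Re \<alpha> \<le> real k"
    and f: "\<And>s. integrable lborel (\<lambda>t. f t * smoothing_kernel \<alpha> k \<psi> (s - t))"
  shows "conv g (nth_deriv k \<psi>) = conv f (smoothing_kernel \<alpha> k \<psi>)"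
proof
  fix s
  obtain \<phi> where \<phi>: "\<And>n. test_fun (\<phi> n)" "Lp_converges p \<phi> f"
    "distr_converges (\<lambda>n. test_differint \<alpha> (\<phi> n)) g"
    using fg by (auto simp: has_differint_def)
  have 1: "0 < Re (of_nat (deriv_order \<alpha>) - \<alpha>)"
    using Re_less_deriv_order[of \<alpha>] by simp
  have "(\<lambda>n. conv (test_differint \<alpha> (\<phi> n)) (nth_deriv k \<psi>) s) \<longlonglongrightarrow> conv g (nth_deriv k \<psi>) s"
    using \<phi>(3) test_fun_reflect_nth_deriv[OF \<psi>] unfolding distr_converges_def conv_def by blast
  moreover have "conv (test_differint \<alpha> (\<phi> n)) (nth_deriv k \<psi>) = conv (\<phi> n) (smoothing_kernel \<alpha> k \<psi>)" for n
    unfolding test_differint_eq_conv smoothing_kernel_def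
    by (rule conv_nth_deriv_delta_kernel[OF \<phi>(1) \<psi> 1])
  moreover have "(\<lambda>n. conv (\<phi> n) (smoothing_kernel \<alpha> k \<psi>) s) \<longlonglongrightarrow> conv f (smoothing_kernel \<alpha> k \<psi>) s"
    unfolding conv_def
  proof -
    obtain C where C: "\<And>x. norm (smoothing_kernel \<alpha> k \<psi> x) \<le> C"
      using bounded_smoothing_kernel[OF \<psi> k] by blast
    have w: "integrable lborel (\<lambda>t. smoothing_kernel \<alpha> k \<psi> (s - t))"
      by (rule integrable_reflect[OF integrable_smoothing_kernel[OF \<psi> k]])
    have m: "\<phi> n \<in> borel_measurable borel" and i: "integrable lborel (\<phi> n)" for n
      using measurable_nth_deriv[OF \<phi>(1), of 0] integrable_nth_deriv[OF \<phi>(1), of 0] by simp_all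
    have "integrable lborel (\<lambda>t. \<phi> n t * smoothing_kernel \<alpha> k \<psi> (s - t))" for n
      by (rule integrable_mult_bounded[OF i _ C]) (use borel_measurable_integrable[OF w] in simp)
    then show "(\<lambda>n. LINT t|lborel. \<phi> n t * smoothing_kernel \<alpha> k \<psi> (s - t))
        \<longlonglongrightarrow> (LINT t|lborel. f t * smoothing_kernel \<alpha> k \<psi> (s - t))"
      by (intro Lp_converges_integral[OF p \<phi>(2) m _ f w C])
  qed
  ultimately show "conv g (nth_deriv k \<psi>) s = conv f (smoothing_kernel \<alpha> k \<psi>) s"
    by (simp add: LIMSEQ_unique)
qed

section \<open>Fourier inversion\<close>

lemma laplace_multiplication_formula:
  assumes f: "integrable lborel f" and q: "integrable lborel q"
  shows "(LINT s|lborel. laplace f (\<i> * of_real s) * q s) = (LINT x|lborel. f x * laplace q (\<i> * of_real x))"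
proof -
  have [measurable]: "f \<in> borel_measurable borel" "q \<in> borel_measurable borel"
    using borel_measurable_integrable[OF f] borel_measurable_integrable[OF q] by simp_all
  have I: "integrable (lborel \<Otimes>\<^sub>M lborel) (\<lambda>(x, s). f x * q s * exp (- (\<i> * of_real s * of_real x)))"
  proof (rule lborel_pair.Fubini_integrable)
    show "integrable lborel (\<lambda>x. LINT s|lborel.
        norm (case (x, s) of (x, s) \<Rightarrow> f x * q s * exp (- (\<i> * of_real s * of_real x))))"
      using f by (simp add: norm_mult)
    show "AE x in lborel. integrable lborel
        (\<lambda>s. case (x, s) of (x, s) \<Rightarrow> f x * q s * exp (- (\<i> * of_real s * of_real x)))"
    proof (rule AE_I2)
      fix x :: real
      show "integrable lborel
        (\<lambda>s. case (x, s) of (x, s) \<Rightarrow> f x * q s * exp (- (\<i> * of_real s * of_real x)))"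
        using integrable_expw_imaginary[OF q, of x] by (simp add: mult.assoc) (simp add: mult_ac)
    qed
  qed measurable
  have "(LINT s|lborel. laplace f (\<i> * of_real s) * q s)
      = (LINT s|lborel. LINT x|lborel. f x * q s * exp (- (\<i> * of_real s * of_real x)))"
    unfolding laplace_def
    by (subst integral_mult_left_zero[symmetric]) (simp add: mult_ac)
  also have "\<dots> = (LINT x|lborel. LINT s|lborel. f x * q s * exp (- (\<i> * of_real s * of_real x)))"
    using lborel_pair.Fubini_integral[OF I] by simp
  also have "\<dots> = (LINT x|lborel. f x * laplace q (\<i> * of_real x))"
    unfolding laplace_def
    by (subst integral_mult_right_zero[symmetric]) (simp add: mult_ac)
  finally show ?thesis .
qed

text \<open>After truncation the function is integrable. Half-lines form an intersection-stable
  generator of the Borel sets, so its integrals vanish over all of them, which forces it to be zero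
  almost everywhere.\<close>

lemma AE_zero_if_interval_integrals_zero:
  fixes f :: "real \<Rightarrow> complex"
  assumes f: "\<And>a b. set_integrable lborel {a..b} f"
    and zero: "\<And>a b. (LINT x:{a..b}|lborel. f x) = 0"
  shows "AE x in lborel. f x = 0"
proof -
  have "AE x in lborel. indicator {- real N..real N} x *\<^sub>R f x = 0" for N :: nat
  proof -
    define g where "g x = indicator {- real N..real N} x *\<^sub>R f x" for x
    have g: "integrable lborel g"
      using f[of "- real N" "real N"] by (simp add: g_def[abs_def] set_integrable_def)
    have gs: "set_integrable lborel A g" if "A \<in> sets borel" for A
      using integrable_mult_indicator[OF _ g, of A] that by (simp add: set_integrable_def)
    have sets: "(sets borel :: real set set) = sigma_sets UNIV (range atMost)"
      using borel_eq_atMost[where 'a=real] by (metis sets_measure_of top_greatest Pow_UNIV)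
    have univ: "(LINT x|lborel. g x) = 0"
      using zero[of "- real N" "real N"] by (simp add: g_def[abs_def] set_lebesgue_integral_def)
    have "(LINT x:A|lborel. g x) = 0" if "A \<in> sigma_sets UNIV (range atMost)" for A
    proof (rule sigma_sets_induct_disjoint[OF _ _ that])
      show "Int_stable (range (atMost :: real \<Rightarrow> real set))"
        by (auto simp: Int_stable_def)
    next
      fix A :: "real set" assume "A \<in> range atMost"
      then obtain a where A: "A = {..a}" by blast
      have "(\<lambda>x. indicator A x *\<^sub>R g x) = (\<lambda>x. indicator {- real N..min a (real N)} x *\<^sub>R f x)"
        by (auto simp: fun_eq_iff A g_def indicator_def)
      then show "(LINT x:A|lborel. g x) = 0"
        using zero[of "- real N" "min a (real N)"] by (simp add: set_lebesgue_integral_def)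
    next
      fix A :: "real set" assume A: "A \<in> sigma_sets UNIV (range atMost)" "(LINT x:A|lborel. g x) = 0"
      have "(\<lambda>x. indicator (UNIV - A) x *\<^sub>R g x) = (\<lambda>x. g x - indicator A x *\<^sub>R g x)"
        by (auto simp: fun_eq_iff indicator_def)
      then show "(LINT x:UNIV - A|lborel. g x) = 0"
        using A univ g gs[of A] by (simp add: set_lebesgue_integral_def sets set_integrable_def)
    next
      fix A :: "nat \<Rightarrow> real set"
      assume A: "disjoint_family A" "range A \<subseteq> sigma_sets UNIV (range atMost)"
        "\<And>i. (LINT x:A i|lborel. g x) = 0"
      have m: "A i \<in> sets borel" for i using A(2) unfolding sets by blast
      have "(LINT x:(\<Union>i. A i)|lborel. g x) = (\<Sum>i. (LINT x:A i|lborel. g x))"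
        using m A(1) by (intro lebesgue_integral_countable_add gs) (auto simp: disjoint_family_on_def)
      then show "(LINT x:(\<Union>i. A i)|lborel. g x) = 0" using A(3) by simp
    qed (auto simp: set_lebesgue_integral_def)
    then have "AE x in lborel. g x = 0"
      by (intro sigma_finite_measure.density_zero[OF lborel.sigma_finite_measure_axioms g]) (simp add: sets)
    then show ?thesis by (simp add: g_def)
  qed
  then have "AE x in lborel. \<forall>N::nat. indicator {- real N..real N} x *\<^sub>R f x = 0"
    unfolding AE_all_countable by blast
  then show ?thesis
  proof eventually_elim
    case (elim x)
    obtain N where "\<bar>x\<bar> \<le> real N" using real_arch_simple by blast
    then have "x \<in> {- real N..real N}" by auto
    with elim[rule_format, of N] show ?case by simp
  qed
qed

section \<open>Gaussians and inversion for integrable transforms\<close>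

definition gauss :: "real \<Rightarrow> complex" where
  "gauss x = of_real (std_normal_density x)"

lemma integrable_gauss: "integrable lborel gauss"
  unfolding gauss_def[abs_def] using integrable_normal_density[of 1 0] by auto

lemma integral_gauss: "(LINT x|lborel. gauss x) = 1"
  unfolding gauss_def[abs_def] by simp

text \<open>This is the characteristic function of the normal distribution, taken at
  \<open>- u\<close> because \<open>char\<close> has the opposite sign in its exponent.\<close>

lemma laplace_gauss: "laplace gauss (\<i> * of_real u) = of_real (sqrt (2 * pi)) * gauss u"
proof -
  have "laplace gauss (\<i> * of_real u) = char std_normal_distribution (- u)"
    unfolding char_def laplace_def gauss_def
    by (subst integral_density) (auto simp: scaleR_conv_of_real mult_ac normal_density_nonneg)
  also have "\<dots> = of_real (exp (- (u\<^sup>2) / 2))"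
    by (simp add: char_std_normal_distribution)
  finally show ?thesis
    by (simp add: gauss_def std_normal_density_def)
qed

lemma laplace_scale:
  assumes "e > 0"
  shows "laplace (\<lambda>x. f (e * x)) z = laplace f (z / of_real e) / of_real e"
proof -
  have "laplace f (z / of_real e) = of_real e * (LINT x|lborel. f (e * x) * exp (- (z / of_real e * of_real (e * x))))"
    unfolding laplace_def using assms
    by (subst lborel_integral_real_affine[of e _ 0]) (auto simp: scaleR_conv_of_real)
  then show ?thesis using assms by (simp add: laplace_def field_simps)
qed

lemma laplace_shift:
  "laplace (\<lambda>s. q s * exp (\<i> * of_real s * of_real t)) (\<i> * of_real x) = laplace q (\<i> * of_real (x - t))"
proof -
  have "exp (\<i> * of_real s * of_real t) * exp (- (\<i> * of_real x * of_real s)) = exp (- (\<i> * of_real (x - t) * of_real s))" for s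
    unfolding exp_add[symmetric] by (simp add: algebra_simps)
  then show ?thesis
    unfolding laplace_def mult.assoc by simp
qed

text \<open>Multiplying the transform by a wide Gaussian amounts to convolving the function with a
  narrow one. In the limit the convolution is only followed through its integrals over intervals.\<close>

lemma laplace_inversion:
  assumes f: "integrable lborel f" and F: "integrable lborel (\<lambda>s. laplace f (\<i> * of_real s))"
  shows "AE t in lborel. f t = laplace (\<lambda>s. laplace f (\<i> * of_real s)) (\<i> * of_real (- t)) / of_real (2 * pi)"
proof -
  define F where "F s = laplace f (\<i> * of_real s)" for s
  define v where "v t = laplace F (\<i> * of_real (- t))" for t
  define e where "e n = 1 / real (Suc n)" for n
  have e: "e n > 0" for n by (simp add: e_def)
  have e_lim: "e \<longlonglongrightarrow> 0"
    unfolding e_def[abs_def] by (intro LIMSEQ_Suc lim_1_over_n)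
  note FI = F[folded F_def]
  have [measurable]: "f \<in> borel_measurable borel" "F \<in> borel_measurable borel" "gauss \<in> borel_measurable borel"
    using borel_measurable_integrable[OF f] borel_measurable_integrable[OF FI]
      borel_measurable_integrable[OF integrable_gauss] by simp_all
  have cont_gauss: "isCont gauss x" for x
    unfolding gauss_def[abs_def] std_normal_density_def by (intro continuous_intros) auto
  have gauss_le: "norm (gauss x) \<le> norm (gauss 0)" for x
    unfolding gauss_def norm_of_real by (simp add: std_normal_density_def divide_right_mono)
  have v_meas[measurable]: "v \<in> borel_measurable borel"
    unfolding v_def[abs_def] using measurable_compose[OF borel_measurable_uminus measurable_laplace_imaginary[OF FI], of "\<lambda>x. x" borel] by simp
  have v_bound: "norm (v t) \<le> (LINT s|lborel. norm (F s))" for t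
    unfolding v_def by (rule norm_laplace_imaginary_le)
  \<comment> \<open>Transform of the wide Gaussian \<open>gauss (e n * s)\<close>:
    \<open>sqrt (2 * pi)\<close> times a probability density of width \<open>e n\<close>.\<close>
  define h where "h n u = of_real (sqrt (2 * pi) / e n) * gauss (u / e n)" for n u
  define J where "J n = conv f (h n)" for n
  have J_eq: "J n t = (LINT s|lborel. F s * gauss (e n * s) * exp (\<i> * of_real s * of_real t))" for n t
  proof -
    have q: "integrable lborel (\<lambda>s. gauss (e n * s) * exp (\<i> * of_real s * of_real t))"
    proof (rule integrable_mult_bounded[of _ _ 1])
      show "integrable lborel (\<lambda>s. gauss (e n * s))"
        using lborel_integrable_real_affine[OF integrable_gauss, of "e n" 0] e[of n] by simp
    qed auto
    have "(LINT s|lborel. F s * (gauss (e n * s) * exp (\<i> * of_real s * of_real t)))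
        = (LINT x|lborel. f x * laplace (\<lambda>s. gauss (e n * s)) (\<i> * of_real (x - t)))"
      unfolding F_def laplace_multiplication_formula[OF f q] laplace_shift ..
    also have "(\<lambda>x. laplace (\<lambda>s. gauss (e n * s)) (\<i> * of_real (x - t))) = (\<lambda>x. h n (t - x))"
    proof
      fix x
      have "laplace (\<lambda>s. gauss (e n * s)) (\<i> * of_real (x - t)) = laplace gauss (\<i> * of_real ((x - t) / e n)) / of_real (e n)"
        using laplace_scale[OF e[of n], of gauss] by simp
      also have "\<dots> = of_real (sqrt (2 * pi) / e n) * gauss ((x - t) / e n)"
        unfolding laplace_gauss by simp
      also have "gauss ((x - t) / e n) = gauss ((t - x) / e n)"
        by (simp add: gauss_def std_normal_density_def power2_commute power_divide)
      finally show "laplace (\<lambda>s. gauss (e n * s)) (\<i> * of_real (x - t)) = h n (t - x)"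
        by (simp add: h_def)
    qed
    finally show ?thesis by (simp add: J_def conv_def mult.assoc)
  qed
  have J_lim: "(\<lambda>n. J n t) \<longlonglongrightarrow> gauss 0 * v t" for t
  proof -
    have "(\<lambda>n. LINT s|lborel. F s * gauss (e n * s) * exp (\<i> * of_real s * of_real t))
       \<longlonglongrightarrow> (LINT s|lborel. F s * gauss 0 * exp (\<i> * of_real s * of_real t))"
    proof (rule integral_dominated_convergence[where w="\<lambda>s. norm (gauss 0) * norm (F s)"])
      show "AE s in lborel. (\<lambda>n. F s * gauss (e n * s) * exp (\<i> * of_real s * of_real t))
          \<longlonglongrightarrow> F s * gauss 0 * exp (\<i> * of_real s * of_real t)"
      proof (rule AE_I2)
        fix s
        have "(\<lambda>n. e n * s) \<longlonglongrightarrow> 0 * s" by (intro tendsto_intros e_lim)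
        then have "(\<lambda>n. gauss (e n * s)) \<longlonglongrightarrow> gauss 0"
          by (intro isCont_tendsto_compose[OF cont_gauss]) simp
        then show "(\<lambda>n. F s * gauss (e n * s) * exp (\<i> * of_real s * of_real t))
          \<longlonglongrightarrow> F s * gauss 0 * exp (\<i> * of_real s * of_real t)"
          by (intro tendsto_intros)
      qed
      show "AE s in lborel. norm (F s * gauss (e n * s) * exp (\<i> * of_real s * of_real t)) \<le> norm (gauss 0) * norm (F s)" for n
        by (rule AE_I2) (use gauss_le in \<open>simp add: norm_mult mult.commute mult_left_mono\<close>)
    qed (use FI in auto)
    also have "(LINT s|lborel. F s * gauss 0 * exp (\<i> * of_real s * of_real t)) = gauss 0 * v t"
      unfolding v_def laplace_def by (subst integral_mult_right_zero[symmetric]) (simp add: mult_ac)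
    finally show ?thesis by (simp only: J_eq)
  qed
  have J_bound: "norm (J n t) \<le> norm (gauss 0) * (LINT s|lborel. norm (F s))" for n t
  proof -
    have "norm (J n t) \<le> (LINT s|lborel. norm (F s * gauss (e n * s) * exp (\<i> * of_real s * of_real t)))"
      unfolding J_eq by (rule integral_norm_bound)
    also have "\<dots> \<le> (LINT s|lborel. norm (gauss 0) * norm (F s))"
      using FI gauss_le by (intro integral_mono_AE') (auto simp: norm_mult mult.commute mult_left_mono)
    finally show ?thesis by simp
  qed
  have hI: "integrable lborel (h n)" for n
    unfolding h_def[abs_def]
    using lborel_integrable_real_affine[OF integrable_gauss, of "1 / e n" 0] e[of n] by simp
  have [measurable]: "J n \<in> borel_measurable borel" for n
    using borel_measurable_integrable[OF integrable_conv[OF f hI]] by (simp add: J_def)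
  \<comment> \<open>The integral of \<open>J n\<close> over an interval has two limits: one by
    letting the Gaussian factor tend to \<open>gauss 0\<close>, the other by letting the convolution
    tend to \<open>sqrt (2 * pi) * f\<close> in the integrated sense.\<close>
  have eq: "gauss 0 * (LINT t:{a..b}|lborel. v t) = of_real (sqrt (2 * pi)) * (LINT t:{a..b}|lborel. f t)" for a b
  proof -
    have "(\<lambda>n. LINT t:{a..b}|lborel. J n t) \<longlonglongrightarrow> (LINT t:{a..b}|lborel. gauss 0 * v t)"
      unfolding set_lebesgue_integral_def
    proof (rule integral_dominated_convergence[where
          w="\<lambda>t. indicator {a..b} t *\<^sub>R (norm (gauss 0) * (LINT s|lborel. norm (F s)))"])
      show "integrable lborel (\<lambda>t. indicator {a..b} t *\<^sub>R (norm (gauss 0) * (LINT s|lborel. norm (F s))))"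
        unfolding set_integrable_def[symmetric] by (rule borel_integrable_atLeastAtMost'[OF continuous_on_const])
      show "AE t in lborel. (\<lambda>n. indicator {a..b} t *\<^sub>R J n t) \<longlonglongrightarrow> indicator {a..b} t *\<^sub>R (gauss 0 * v t)"
        by (intro AE_I2 tendsto_intros J_lim)
      show "AE t in lborel. norm (indicator {a..b} t *\<^sub>R J n t)
          \<le> indicator {a..b} t *\<^sub>R (norm (gauss 0) * (LINT s|lborel. norm (F s)))" for n
        by (rule AE_I2) (simp add: J_bound indicator_def)
    qed measurable
    moreover have "(\<lambda>n. LINT t:{a..b}|lborel. J n t) \<longlonglongrightarrow>
        (LINT x|lborel. f x * (of_real (sqrt (2 * pi)) * indicator {a..b} x))"
    proof -
      \<comment> \<open>The indicator smoothed at scale \<open>e n\<close>. It converges to the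
        indicator except possibly at \<open>a\<close> and \<open>b\<close>, a null set, so the
        argument rests on the regularity of the indicator and not of \<open>f\<close>.\<close>
      define \<theta> where "\<theta> n x = (LINT w|lborel. gauss w * indicator {a..b} (x + e n * w))" for n x
      have ind_le: "norm (gauss w * indicator {a..b} y) \<le> norm (gauss w)" for w y
        by (simp add: indicator_def)
      have J\<theta>: "(LINT t:{a..b}|lborel. J n t) = (LINT x|lborel. f x * (of_real (sqrt (2 * pi)) * \<theta> n x))" for n
      proof -
        \<comment> \<open>Reflecting the indicator turns the integral over \<open>{a..b}\<close>
          into a convolution at \<open>0\<close>, so \<open>conv_assoc\<close> can move
          \<open>h n\<close> away from \<open>f\<close>.\<close>
        define ind :: "real \<Rightarrow> complex" where "ind x = indicator {a..b} (- x)" for x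
        have "(LINT t:{a..b}|lborel. J n t) = conv (conv f (h n)) ind 0"
          unfolding conv_def[of _ ind] J_def set_lebesgue_integral_def
          by (rule Bochner_Integration.integral_cong[OF refl]) (simp add: ind_def indicator_def)
        also have "\<dots> = conv f (conv (h n) ind) 0"
        proof -
          have "ind \<in> borel_measurable borel" unfolding ind_def[abs_def] by measurable
          moreover have "norm (ind x) \<le> 1" for x by (simp add: ind_def indicator_def)
          ultimately show ?thesis using conv_assoc[OF f hI] by metis
        qed
        also have "\<dots> = (LINT x|lborel. f x * (of_real (sqrt (2 * pi)) * \<theta> n x))"
        proof -
          have "conv (h n) ind (0 - x) = of_real (sqrt (2 * pi)) * \<theta> n x" for x
          proof -
            have "conv (h n) ind (0 - x) = (LINT y|lborel. h n y * indicator {a..b} (x + y))"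
              by (simp add: conv_def ind_def add.commute)
            also have "\<dots> = of_real (e n) * (LINT w|lborel. h n (e n * w) * indicator {a..b} (x + e n * w))"
              using e[of n] by (subst lborel_integral_real_affine[of "e n" _ 0]) (auto simp: scaleR_conv_of_real)
            also have "(LINT w|lborel. h n (e n * w) * indicator {a..b} (x + e n * w)) = of_real (sqrt (2 * pi) / e n) * \<theta> n x"
              unfolding \<theta>_def h_def using e[of n] by (subst integral_mult_right_zero[symmetric]) (simp add: mult.assoc)
            finally show ?thesis using e[of n] by simp
          qed
          then show ?thesis unfolding conv_def[of f] by simp
        qed
        finally show ?thesis .
      qed
      have [measurable]: "\<theta> n \<in> borel_measurable borel" for n
        unfolding \<theta>_def[abs_def] by measurable
      have \<theta>_le: "norm (\<theta> n x) \<le> 1" for n x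
      proof -
        have "norm (\<theta> n x) \<le> (LINT w|lborel. norm (gauss w * indicator {a..b} (x + e n * w)))"
          unfolding \<theta>_def by (rule integral_norm_bound)
        also have "\<dots> \<le> (LINT w|lborel. norm (gauss w))"
          using ind_le integrable_gauss by (intro integral_mono_AE') auto
        also have "\<dots> = 1"
          by (simp add: gauss_def)
        finally show ?thesis .
      qed
      have \<theta>_lim: "(\<lambda>n. \<theta> n x) \<longlonglongrightarrow> indicator {a..b} x" if "x \<noteq> a" "x \<noteq> b" for x
      proof -
        have "(\<lambda>n. \<theta> n x) \<longlonglongrightarrow> (LINT w|lborel. gauss w * indicator {a..b} x)"
          unfolding \<theta>_def
        proof (rule integral_dominated_convergence[where w="\<lambda>w. norm (gauss w)"])
          show "AE w in lborel. (\<lambda>n. gauss w * indicator {a..b} (x + e n * w)) \<longlonglongrightarrow> gauss w * indicator {a..b} x"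
          proof (rule AE_I2)
            fix w
            have l: "(\<lambda>n. x + e n * w) \<longlonglongrightarrow> x + 0 * w" by (intro tendsto_intros e_lim)
            have "x \<notin> frontier {a..b}" using that by (cases "a \<le> b") (auto simp: frontier_cbox[of a b, simplified])
            then have "isCont (indicator {a..b} :: real \<Rightarrow> real) x"
              by (simp add: isCont_indicator)
            from isCont_tendsto_compose[OF this, of "\<lambda>n. x + e n * w"] l
            have "(\<lambda>n. complex_of_real (indicator {a..b} (x + e n * w))) \<longlonglongrightarrow> of_real (indicator {a..b} x)"
              by (intro tendsto_of_real) simp
            moreover have "complex_of_real (indicator {a..b} y) = indicator {a..b} y" for y
              by (simp add: indicator_def)
            ultimately have "(\<lambda>n. indicator {a..b} (x + e n * w) :: complex) \<longlonglongrightarrow> indicator {a..b} x"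
              by simp
            then show "(\<lambda>n. gauss w * indicator {a..b} (x + e n * w)) \<longlonglongrightarrow> gauss w * indicator {a..b} x"
              by (intro tendsto_intros)
          qed
        qed (use integrable_gauss ind_le in auto)
        then show ?thesis by (simp add: integral_gauss)
      qed
      show ?thesis
        unfolding J\<theta>
      proof (rule integral_dominated_convergence[where w="\<lambda>x. sqrt (2 * pi) * norm (f x)"])
        have "AE x in lborel. x \<noteq> a \<and> x \<noteq> b" by (simp add: AE_lborel_singleton)
        then show "AE x in lborel. (\<lambda>n. f x * (of_real (sqrt (2 * pi)) * \<theta> n x))
            \<longlonglongrightarrow> f x * (of_real (sqrt (2 * pi)) * indicator {a..b} x)"
          by eventually_elim (intro tendsto_intros \<theta>_lim, auto)
        show "AE x in lborel. norm (f x * (of_real (sqrt (2 * pi)) * \<theta> n x)) \<le> sqrt (2 * pi) * norm (f x)" for n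
        proof (rule AE_I2)
          fix x
          have "(sqrt (2 * pi) * norm (f x)) * norm (\<theta> n x) \<le> (sqrt (2 * pi) * norm (f x)) * 1"
            by (intro mult_left_mono \<theta>_le) simp
          then show "norm (f x * (of_real (sqrt (2 * pi)) * \<theta> n x)) \<le> sqrt (2 * pi) * norm (f x)"
            by (simp add: norm_mult mult_ac)
        qed
      qed (use f in auto)
    qed
    ultimately have "(LINT t:{a..b}|lborel. gauss 0 * v t)
        = (LINT x|lborel. f x * (of_real (sqrt (2 * pi)) * indicator {a..b} x))"
      by (rule LIMSEQ_unique)
    also have "\<dots> = of_real (sqrt (2 * pi)) * (LINT t:{a..b}|lborel. f t)"
      unfolding set_lebesgue_integral_def
      by (subst integral_mult_right_zero[symmetric], rule Bochner_Integration.integral_cong[OF refl])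
        (simp add: indicator_def)
    finally show ?thesis by simp
  qed
  have "AE t in lborel. f t - v t / of_real (2 * pi) = 0"
  proof (rule AE_zero_if_interval_integrals_zero)
    fix a b
    have fs: "set_integrable lborel {a..b} f"
      using integrable_mult_indicator[OF _ f, of "{a..b}"] by (simp add: set_integrable_def)
    have vs: "set_integrable lborel {a..b} v"
      unfolding set_integrable_def
    proof (rule Bochner_Integration.integrable_bound)
      show "integrable lborel (\<lambda>t. indicator {a..b} t *\<^sub>R (LINT s|lborel. norm (F s)))"
        unfolding set_integrable_def[symmetric] by (rule borel_integrable_atLeastAtMost'[OF continuous_on_const])
      show "AE t in lborel. norm (indicator {a..b} t *\<^sub>R v t)
          \<le> norm (indicator {a..b} t *\<^sub>R (LINT s|lborel. norm (F s)))"
        using v_bound by (auto simp: indicator_def intro!: AE_I2 order_trans[OF v_bound abs_ge_self])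
    qed measurable
    show "set_integrable lborel {a..b} (\<lambda>t. f t - v t / of_real (2 * pi))"
      using fs vs by (intro set_integral_diff(1) set_integrable_divide) auto
    \<comment> \<open>With \<open>eq\<close>, this value of \<open>gauss 0\<close> produces the
      factor \<open>2 * pi\<close> of the inversion formula.\<close>
    have "gauss 0 * of_real (sqrt (2 * pi)) = 1"
      by (simp add: gauss_def std_normal_density_def flip: of_real_mult)
    then have "of_real (sqrt (2 * pi)) * (gauss 0 * (LINT t:{a..b}|lborel. v t)) = (LINT t:{a..b}|lborel. v t)"
      by (metis mult.assoc mult.commute mult_1)
    then have "(LINT t:{a..b}|lborel. v t) = of_real (2 * pi) * (LINT t:{a..b}|lborel. f t)"
      unfolding eq by (simp add: mult.assoc[symmetric] flip: of_real_mult)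
    then show "(LINT t:{a..b}|lborel. f t - v t / of_real (2 * pi)) = 0"
      using fs vs by (subst set_integral_diff(2)) auto
  qed
  then show ?thesis
    by eventually_elim (simp add: v_def F_def[abs_def])
qed

section \<open>The transform of a differintegral\<close>

lemma fourier_eq_laplace:
  "fourier f \<omega> = of_real (1 / sqrt (2 * pi)) * laplace f (\<i> * of_real \<omega>)"
  by (simp add: fourier_def laplace_def)

lemma inv_fourier_eq_laplace:
  "inv_fourier g t = of_real (1 / sqrt (2 * pi)) * laplace g (\<i> * of_real (- t))"
  by (simp add: inv_fourier_def laplace_def mult_ac)

lemma laplace_mult_right: "laplace (\<lambda>s. q s * a) z = laplace q z * a"
  unfolding laplace_def by (subst integral_mult_left_zero[symmetric]) (simp add: mult_ac)

text \<open>On the imaginary axis without \<open>0\<close>, \<open>arg_cut\<close> is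
  \<open>pi / 2\<close> or \<open>- pi / 2\<close>, which lies in the principal range. The two
  branches therefore agree there, even on the half-axis that is the cut, and facts about the
  principal \<open>powr\<close> apply.\<close>

lemma cut_power_imaginary:
  assumes "\<omega> \<noteq> 0"
  shows "cut_power (\<i> * of_real \<omega>) \<alpha> = (\<i> * of_real \<omega>) powr \<alpha>"
proof -
  have ii: "\<i> * (\<i> * of_real \<omega>) = of_real (- \<omega>)" by simp
  have arg: "arg_cut (\<i> * of_real \<omega>) = (if \<omega> > 0 then pi / 2 else - pi / 2)"
  proof (cases "\<omega> > 0")
    case True
    then have "Arg2pi (of_real (- \<omega>)) = pi"
      by (subst Arg2pi_eq_pi) auto
    then show ?thesis unfolding arg_cut_def ii using True by simp
  next
    case False
    then have "Arg2pi (of_real (- \<omega>)) = 0"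
      by (subst Arg2pi_eq_0) auto
    then show ?thesis unfolding arg_cut_def ii using False by simp
  qed
  have "Ln (\<i> * of_real \<omega>) = Complex (ln (cmod (\<i> * of_real \<omega>))) (arg_cut (\<i> * of_real \<omega>))"
  proof (rule Ln_unique)
    show "exp (Complex (ln (cmod (\<i> * of_real \<omega>))) (arg_cut (\<i> * of_real \<omega>))) = \<i> * of_real \<omega>"
      using assms unfolding arg by (auto simp: complex_eq_iff Re_exp Im_exp norm_mult)
    show "- pi < Im (Complex (ln (cmod (\<i> * of_real \<omega>))) (arg_cut (\<i> * of_real \<omega>)))"
      "Im (Complex (ln (cmod (\<i> * of_real \<omega>))) (arg_cut (\<i> * of_real \<omega>))) \<le> pi"
      unfolding arg complex.sel by (smt (verit) pi_gt_zero field_sum_of_halves)+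
  qed
  then show ?thesis
    using assms by (simp add: cut_power_def powr_def)
qed

text \<open>Transforming the convolution identity gives the claim multiplied by
  \<open>(\<i> * \<omega>) ^ k\<close> and the transform of \<open>\<psi>\<close>; both are nonzero
  and cancel.\<close>

lemma fourier_differint_nonzero:
  assumes p: "1 \<le> p" and f: "integrable lborel f" and g: "integrable lborel g"
    and fg: "has_differint p \<alpha> f g" and \<omega>: "\<omega> \<noteq> 0"
  shows "laplace g (\<i> * of_real \<omega>) = (\<i> * of_real \<omega>) powr \<alpha> * laplace f (\<i> * of_real \<omega>)"
proof -
  \<comment> \<open>This width makes \<open>\<bar>\<omega>\<bar>\<close> times the width at most
    \<open>1\<close>, as \<open>laplace_bump_nonzero\<close> asks.\<close>
  define \<psi> where "\<psi> = bump (1 / (\<bar>\<omega>\<bar> + 1))"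
  have \<psi>: "test_fun \<psi>" unfolding \<psi>_def by (rule test_fun_bump)
  have nz: "laplace \<psi> (\<i> * of_real \<omega>) \<noteq> 0"
    unfolding \<psi>_def by (rule laplace_bump_nonzero) (auto simp: field_simps)
  obtain k where k: "1 - Re \<alpha> \<le> real k" using real_arch_simple by blast
  let ?W = "smoothing_kernel \<alpha> k \<psi>"
  obtain C where C: "\<And>x. norm (?W x) \<le> C"
    using bounded_smoothing_kernel[OF \<psi> k] by blast
  have W: "integrable lborel ?W" by (rule integrable_smoothing_kernel[OF \<psi> k])
  have [measurable]: "?W \<in> borel_measurable borel"
    using borel_measurable_integrable[OF W] by simp
  have "conv g (nth_deriv k \<psi>) = conv f ?W"
  proof (rule has_differint_conv[OF p fg \<psi> k])
    show "integrable lborel (\<lambda>t. f t * ?W (s - t))" for s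
      by (rule integrable_mult_bounded[OF f _ C]) measurable
  qed
  then have "laplace (conv g (nth_deriv k \<psi>)) (\<i> * of_real \<omega>) = laplace (conv f ?W) (\<i> * of_real \<omega>)"
    by simp
  then have "laplace g (\<i> * of_real \<omega>) * ((\<i> * of_real \<omega>) ^ k * laplace \<psi> (\<i> * of_real \<omega>))
     = laplace f (\<i> * of_real \<omega>) * ((\<i> * of_real \<omega>) ^ k * (\<i> * of_real \<omega>) powr \<alpha> * laplace \<psi> (\<i> * of_real \<omega>))"
    by (simp only: laplace_conv integrable_expw_imaginary f g W integrable_nth_deriv[OF \<psi>]
        laplace_nth_deriv[OF \<psi>] laplace_smoothing_kernel[OF \<psi> k \<omega>])
  then show ?thesis using nz \<omega> by (simp add: mult_ac)
qed

text \<open>At frequency \<open>0\<close> both transforms are limits along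
  \<open>1 / (n + 1)\<close>, by continuity. The power converges to
  \<open>cut_power 0 \<alpha>\<close>: it is constantly \<open>1\<close> for
  \<open>\<alpha> = 0\<close> and tends to \<open>0\<close> for
  \<open>Re \<alpha> > 0\<close>.\<close>

lemma fourier_differint:
  assumes p: "1 \<le> p" and f: "integrable lborel f" and g: "integrable lborel g"
    and fg: "has_differint p \<alpha> f g" and \<omega>: "\<omega> \<noteq> 0 \<or> \<alpha> = 0 \<or> 0 < Re \<alpha>"
  shows "fourier g \<omega> = cut_power (\<i> * of_real \<omega>) \<alpha> * fourier f \<omega>"
proof (cases "\<omega> = 0")
  case False
  then show ?thesis
    by (simp add: fourier_eq_laplace cut_power_imaginary fourier_differint_nonzero[OF p f g fg])
next
  case True
  define w where "w n = 1 / real (Suc n)" for n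
  have w: "w \<longlonglongrightarrow> 0" unfolding w_def[abs_def] by (intro LIMSEQ_Suc lim_1_over_n)
  have L: "(\<lambda>n. laplace q (\<i> * of_real (w n))) \<longlonglongrightarrow> laplace q (\<i> * of_real 0)"
    if "integrable lborel q" for q
    by (rule isCont_tendsto_compose[OF continuous_laplace_imaginary[OF that] w])
  have "(\<lambda>n. (\<i> * of_real (w n)) powr \<alpha>) \<longlonglongrightarrow> cut_power 0 \<alpha>"
  proof (cases "\<alpha> = 0")
    case True
    have "w n \<noteq> 0" for n by (simp add: w_def)
    then show ?thesis using True by (simp add: cut_power_def)
  next
    case False
    have "(\<lambda>n. \<i> * of_real (w n)) \<longlonglongrightarrow> \<i> * of_real 0" by (intro tendsto_intros w)
    then show ?thesis
      using False True \<omega> by (auto simp: cut_power_def intro!: tendsto_powr_complex_0)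
  qed
  from tendsto_mult[OF this L[OF f]]
  have "(\<lambda>n. laplace g (\<i> * of_real (w n))) \<longlonglongrightarrow> cut_power 0 \<alpha> * laplace f (\<i> * of_real 0)"
    by (subst fourier_differint_nonzero[OF p f g fg]) (simp_all add: w_def)
  with L[OF g] have "laplace g (\<i> * of_real 0) = cut_power 0 \<alpha> * laplace f (\<i> * of_real 0)"
    by (rule LIMSEQ_unique)
  then show ?thesis using True by (simp add: fourier_eq_laplace)
qed

text \<open>Convolving a Fourier transform with an integrable kernel multiplies the original function
  by a bounded one. Inversion is applied to this product, which, unlike \<open>f\<close>, has an integrable
  transform.\<close>

lemma conv_fourier:
  assumes f: "integrable lborel f" and w: "integrable lborel w"
  shows "conv (fourier f) w s
    = of_real (1 / sqrt (2 * pi)) * laplace (\<lambda>t. f t * laplace w (\<i> * of_real (- t))) (\<i> * of_real s)"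
proof -
  have refl: "laplace (\<lambda>x. w (s - x)) (\<i> * of_real t) = laplace w (\<i> * of_real (- t)) * exp (- (\<i> * of_real s * of_real t))" for t
  proof -
    have "laplace (\<lambda>x. w (s - x)) (\<i> * of_real t) = (LINT x|lborel. w x * exp (- (\<i> * of_real t * of_real (s - x))))"
      unfolding laplace_def
      using lborel_integral_reflect[of "\<lambda>x. w x * exp (- (\<i> * of_real t * of_real (s - x)))" s] by simp
    also have "(\<lambda>x. exp (- (\<i> * of_real t * of_real (s - x))))
        = (\<lambda>x. exp (- (\<i> * of_real (- t) * of_real x)) * exp (- (\<i> * of_real s * of_real t)))"
      unfolding exp_add[symmetric] by (simp add: algebra_simps)
    finally show ?thesis
      unfolding laplace_def mult.assoc[symmetric] by (simp only: integral_mult_left_zero)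
  qed
  have "conv (fourier f) w s
      = of_real (1 / sqrt (2 * pi)) * (LINT x|lborel. laplace f (\<i> * of_real x) * w (s - x))"
    unfolding conv_def fourier_eq_laplace mult.assoc by (rule integral_mult_right_zero)
  also have "(LINT x|lborel. laplace f (\<i> * of_real x) * w (s - x))
      = (LINT t|lborel. f t * laplace (\<lambda>x. w (s - x)) (\<i> * of_real t))"
    by (rule laplace_multiplication_formula[OF f integrable_reflect[OF w]])
  also have "\<dots> = laplace (\<lambda>t. f t * laplace w (\<i> * of_real (- t))) (\<i> * of_real s)"
    unfolding refl laplace_def[of "\<lambda>t. f t * _ t"] by (simp only: mult.assoc)
  finally show ?thesis .
qed

text \<open>Inversion recovers \<open>f\<close> times the transform of the smoothing kernel, and the
  common factor cancels where the transform of the test function is nonzero. The exceptional null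
  set depends on the test function, so countably many of these must suffice.\<close>

lemma inv_fourier_differint:
  assumes p: "1 \<le> p" and f: "integrable lborel f" and h: "integrable lborel h"
    and fh: "has_differint p \<alpha> (fourier f) h"
  shows "AE t in lborel. inv_fourier h t = cut_power (- \<i> * of_real t) \<alpha> * f t"
proof -
  \<comment> \<open>One factor \<open>c\<close> comes from \<open>fourier\<close>, one from
    \<open>inv_fourier\<close>, and \<open>2 * pi\<close> from the inversion formula; their product
    is \<open>1\<close>.\<close>
  define c :: complex where "c = of_real (1 / sqrt (2 * pi))"
  have c: "c \<noteq> 0" "c * c * of_real (2 * pi) = 1"
    by (simp_all add: c_def flip: of_real_mult)
  obtain k where k: "1 - Re \<alpha> \<le> real k" using real_arch_simple by blast
  \<comment> \<open>The bump of width \<open>1 / (m + 1)\<close> has nonzero transform at all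
    frequencies up to \<open>m + 1\<close> in modulus, so every \<open>t\<close> is served by some
    \<open>m\<close>.\<close>
  define \<psi> where "\<psi> m = bump (1 / real (Suc m))" for m
  have \<psi>: "test_fun (\<psi> m)" for m unfolding \<psi>_def by (rule test_fun_bump)
  have *: "AE t in lborel. t \<noteq> 0 \<longrightarrow> laplace \<psi>' (\<i> * of_real (- t)) \<noteq> 0 \<longrightarrow>
      inv_fourier h t = (\<i> * of_real (- t)) powr \<alpha> * f t" if \<psi>': "test_fun \<psi>'" for \<psi>'
  proof -
    let ?W = "smoothing_kernel \<alpha> k \<psi>'"
    define P where "P t = f t * laplace ?W (\<i> * of_real (- t))" for t
    have W: "integrable lborel ?W" by (rule integrable_smoothing_kernel[OF \<psi>' k])
    have D: "integrable lborel (nth_deriv k \<psi>')" by (rule integrable_nth_deriv[OF \<psi>'])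
    have [measurable]: "(\<lambda>t. laplace q (\<i> * of_real (- t))) \<in> borel_measurable borel"
      if "integrable lborel q" for q
      using measurable_compose[OF borel_measurable_uminus measurable_laplace_imaginary[OF that], of "\<lambda>x. x" borel]
      by simp
    have P: "integrable lborel P"
      unfolding P_def[abs_def]
      by (rule integrable_mult_bounded[OF f _ norm_laplace_imaginary_le]) (use W in measurable)
    have "conv h (nth_deriv k \<psi>') = conv (fourier f) ?W"
    proof (rule has_differint_conv[OF p fh \<psi>' k])
      show "integrable lborel (\<lambda>t. fourier f t * ?W (s - t))" for s
      proof -
        have "integrable lborel (\<lambda>t. ?W (s - t) * laplace f (\<i> * of_real t))"
          by (rule integrable_mult_bounded[OF integrable_reflect[OF W] _ norm_laplace_imaginary_le])
             (use f in measurable)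
        from integrable_mult_right[OF this, of "of_real (1 / sqrt (2 * pi))"]
        show ?thesis by (simp add: fourier_eq_laplace mult_ac)
      qed
    qed
    then have conv_eq: "conv h (nth_deriv k \<psi>') s = c * laplace P (\<i> * of_real s)" for s
      unfolding conv_fourier[OF f W] c_def P_def[abs_def] by simp
    \<comment> \<open>Here integrability of \<open>h\<close> enters: the transform of
      \<open>P\<close> becomes a convolution of integrable functions.\<close>
    then have lap: "(\<lambda>s. laplace P (\<i> * of_real s)) = (\<lambda>s. conv h (nth_deriv k \<psi>') s * (1 / c))"
      using c by simp
    have "AE t in lborel. P t = laplace (\<lambda>s. laplace P (\<i> * of_real s)) (\<i> * of_real (- t)) / of_real (2 * pi)"
    proof (rule laplace_inversion[OF P])
      show "integrable lborel (\<lambda>s. laplace P (\<i> * of_real s))"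
        unfolding lap by (intro integrable_mult_left integrable_conv h D)
    qed
    then show ?thesis
    proof eventually_elim
      case (elim t)
      show ?case
      proof (intro impI)
        assume t: "t \<noteq> 0" and nz: "laplace \<psi>' (\<i> * of_real (- t)) \<noteq> 0"
        let ?z = "\<i> * of_real (- t)"
        have "laplace (\<lambda>s. laplace P (\<i> * of_real s)) ?z = laplace (conv h (nth_deriv k \<psi>')) ?z * (1 / c)"
          unfolding lap by (rule laplace_mult_right)
        also have "laplace (conv h (nth_deriv k \<psi>')) ?z = laplace h ?z * (?z ^ k * laplace \<psi>' ?z)"
          by (simp only: laplace_conv integrable_expw_imaginary h D laplace_nth_deriv[OF \<psi>'])
        finally have "P t = laplace h ?z * (?z ^ k * laplace \<psi>' ?z) * (1 / c) / of_real (2 * pi)"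
          using elim by simp
        moreover have "laplace ?W ?z = ?z ^ k * ?z powr \<alpha> * laplace \<psi>' ?z"
          by (rule laplace_smoothing_kernel[OF \<psi>' k]) (use t in simp)
        ultimately have "f t * (?z ^ k * ?z powr \<alpha> * laplace \<psi>' ?z)
            = laplace h ?z * (?z ^ k * laplace \<psi>' ?z) * (1 / c) / of_real (2 * pi)"
          by (simp only: P_def)
        also have "\<dots> = (c * laplace h ?z) * (?z ^ k * laplace \<psi>' ?z)"
          using c by (simp add: field_simps)
        finally have "(?z ^ k * laplace \<psi>' ?z) * (?z powr \<alpha> * f t) = (?z ^ k * laplace \<psi>' ?z) * (c * laplace h ?z)"
          by (simp only: mult_ac)
        moreover have "?z ^ k * laplace \<psi>' ?z \<noteq> 0" using nz t by simp
        ultimately have "?z powr \<alpha> * f t = c * laplace h ?z"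
          by (metis mult_left_cancel)
        then show "inv_fourier h t = ?z powr \<alpha> * f t"
          by (simp only: inv_fourier_eq_laplace c_def)
      qed
    qed
  qed
  have "AE t in lborel. \<forall>m. t \<noteq> 0 \<longrightarrow> laplace (\<psi> m) (\<i> * of_real (- t)) \<noteq> 0 \<longrightarrow>
      inv_fourier h t = (\<i> * of_real (- t)) powr \<alpha> * f t"
    unfolding AE_all_countable using *[OF \<psi>] by blast
  moreover have "AE t in lborel. t \<noteq> (0::real)" by (rule AE_lborel_singleton)
  ultimately show ?thesis
  proof eventually_elim
    case (elim t)
    obtain m where "\<bar>t\<bar> \<le> real m" using real_arch_simple by blast
    then have "laplace (\<psi> m) (\<i> * of_real (- t)) \<noteq> 0"
      unfolding \<psi>_def by (intro laplace_bump_nonzero) (auto simp: field_simps)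
    with elim have "inv_fourier h t = (\<i> * of_real (- t)) powr \<alpha> * f t" by blast
    also have "\<dots> = cut_power (\<i> * of_real (- t)) \<alpha> * f t"
      using elim by (subst cut_power_imaginary) auto
    finally show ?case by simp
  qed
qed

text \<open>The second identity is one almost everywhere because \<open>fourier f\<close> sees
  \<open>f\<close> only up to null sets. For \<open>\<alpha> \<noteq> 0\<close> with
  \<open>Re \<alpha> \<le> 0\<close> the power has no finite limit at frequency \<open>0\<close>,
  and the value \<open>0\<close> of \<open>cut_power\<close> there is a default.\<close>

theorem theorem3:
  fixes \<alpha> :: complex and f :: "real \<Rightarrow> complex" and p :: ereal
  assumes "1 \<le> p" and "integrable lborel f"
  shows "(\<forall>g. has_differint p \<alpha> f g \<and> integrable lborel g \<longrightarrow>
            (\<forall>\<omega>. \<omega> \<noteq> 0 \<or> \<alpha> = 0 \<or> 0 < Re \<alpha> \<longrightarrow>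
              fourier g \<omega> = cut_power (\<i> * complex_of_real \<omega>) \<alpha> * fourier f \<omega>)) \<and>
         (\<forall>h. has_differint p \<alpha> (fourier f) h \<and> integrable lborel h \<longrightarrow>
            (AE t in lborel.
              inv_fourier h t = cut_power (- \<i> * complex_of_real t) \<alpha> * f t))"
  using fourier_differint[OF assms(1,2)] inv_fourier_differint[OF assms(1,2)] by blast

end
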